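(* Let $K$ be a field, let $\nu$ be a valuation on $K[x]$, and let $\phi\in\mathrm{KP}(\nu)$ be a MLV key polynomial for $\nu$. Then $\phi$ is a key polynomial for $\nu$ if and only if $\deg(\phi)=\deg(\nu)$. In this case, $\nu_\phi=\nu$.
   Context: Valuations. A valuation $\nu$ on $K[x]$ is a map $\nu\colon K[x]\to\Lambda\cup\{\infty\}$ ($\Lambda$ a totally ordered abelian group) with $\nu(fg)=\nu(f)+\nu(g)$, $\nu(f+g)\ge\min\{\nu(f),\nu(g)\}$, whose restriction to $K$ is a valuation of the field $K$. Its value group $\Gamma_\nu$ is generated by the finite values of $\nu$; $(\Gamma_\nu)_{\mathbb Q}=\Gamma_\nu\otimes\mathbb Q$. MLV key polynomials. Let $\mathcal P_\alpha=\{g:\nu(g)\ge\alpha\}\supset\mathcal P_\alpha^+=\{g:\nu(g)>\alpha\}$, and let $\mathcal G_\nu=\bigoplus_{\alpha\in\Gamma_\nu}\mathcal P_\alpha/\mathcal P_\alpha^+$ be the graded algebra, with $\operatorname{in}_\nu g=g+\mathcal P_{\nu(g)}^+$ if $\nu(g)<\infty$, and $\operatorname{in}_\nu g=0$ otherwise. Write $h\mid_\nu g$ if $\operatorname{in}_\nu h$ divides $\operatorname{in}_\nu g$ in $\mathcal G_\nu$. A MacLane-Vaquié (MLV) key polynomial for $\nu$ is a monic $g\in K[x]$ such that $(\operatorname{in}_\nu g)\mathcal G_\nu$ is a non-zero prime ideal and $g\nmid_\nu f$ for every non-zero $f$ with $\deg f<\deg g$. The set of these is $\mathrm{KP}(\nu)$;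 if non-empty, $\deg(\nu)$ is the minimal degree of an element of $\mathrm{KP}(\nu)$. Truncation. For a monic non-constant $Q$ and $f=\sum_s a_sQ^s$ with $\deg a_s<\deg Q$, $\nu_Q(f)=\min_s\nu(a_sQ^s)$. (Abstract) key polynomials. For $b\ge0$, $\partial_b$ is defined by $f(x+y)=\sum_{b\ge0}\partial_b(f)y^b$. For non-constant $f$ with $\nu(f)<\infty$ set $\epsilon(f)=\max_{b\ge1}\frac{\nu(f)-\nu(\partial_b(f))}{b}\in(\Gamma_\nu)_{\mathbb Q}$; set $\epsilon(f)=\infty$ if $\nu(f)=\infty$. A monic (non-constant) $Q\in K[x]$ is a key polynomial for $\nu$ if $0<\deg f<\deg Q$ implies $\epsilon(f)<\epsilon(Q)$, for all $f\in K[x]$. *)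

theory Defs
  imports
    "HOL-Computational_Algebra.Polynomial"
    "HOL-Algebra.Ideal"
    "HOL-Algebra.Divisibility"
    "HOL-Algebra.Product_Groups"
begin

section \<open>Totally ordered groups with a largest element adjoined\<close>

datatype 'v extval = Fin 'v | Infty

instantiation extval :: (linorder) linorder
begin

fun less_eq_extval :: "'a extval \<Rightarrow> 'a extval \<Rightarrow> bool" where
  "Fin a \<le> Fin b \<longleftrightarrow> a \<le> b"
| "x \<le> Infty \<longleftrightarrow> True"
| "Infty \<le> Fin b \<longleftrightarrow> False"

definition less_extval :: "'a extval \<Rightarrow> 'a extval \<Rightarrow> bool" where
  "x < y \<longleftrightarrow> x \<le> y \<and> \<not> y \<le> (x :: 'a extval)"

instance
proof
  fix x y z :: "'a extval"
  show "x < y \<longleftrightarrow> x \<le> y \<and> \<not> y \<le> x"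
    by (rule less_extval_def)
  show "x \<le> x"
    by (cases x) auto
  show "x \<le> y \<Longrightarrow> y \<le> z \<Longrightarrow> x \<le> z"
    by (cases x; cases y; cases z) auto
  show "x \<le> y \<Longrightarrow> y \<le> x \<Longrightarrow> x = y"
    by (cases x; cases y) auto
  show "x \<le> y \<or> y \<le> x"
    by (cases x; cases y) auto
qed

end

lemma Fin_less_simps [simp]:
  "Fin a < Fin b \<longleftrightarrow> a < b" "Fin a < Infty" "\<not> Infty < x"
  for a b :: "'a::linorder"
  by (cases x; auto simp: less_extval_def)+

instantiation extval :: (comm_monoid_add) comm_monoid_add
begin

definition zero_extval :: "'a extval" where
  "0 = Fin 0"

fun plus_extval :: "'a extval \<Rightarrow> 'a extval \<Rightarrow> 'a extval" where
  "Fin a + Fin b = Fin (a + b)"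
| "Infty + x = Infty"
| "Fin a + Infty = Infty"

instance
proof
  fix x y z :: "'a extval"
  show "x + y + z = x + (y + z)"
    by (cases x; cases y; cases z) (auto simp: add.assoc)
  show "x + y = y + x"
    by (cases x; cases y) (auto simp: add.commute)
  show "0 + x = x"
    by (cases x) (auto simp: zero_extval_def)
qed

end


section \<open>Divisible hulls\<close>

primrec nsmult :: "nat \<Rightarrow> 'v::comm_monoid_add \<Rightarrow> 'v" where
  "nsmult 0 a = 0"
| "nsmult (Suc n) a = a + nsmult n a"

lemma nsmult_one [simp]: "nsmult (Suc 0) a = a"
  by simp

lemma nsmult_zero [simp]: "nsmult n 0 = 0"
  by (induction n) auto

lemma nsmult_add: "nsmult n (a + b) = nsmult n a + nsmult n b"
  by (induction n) (auto simp: ac_simps)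

lemma nsmult_add_left: "nsmult (m + n) a = nsmult m a + nsmult n a"
  by (induction m) (auto simp: ac_simps)

lemma nsmult_mult: "nsmult (m * n) a = nsmult m (nsmult n a)"
  by (induction m) (auto simp: nsmult_add_left)

lemma nsmult_commute: "nsmult m (nsmult n a) = nsmult n (nsmult m a)"
  by (metis nsmult_mult mult.commute)

lemma nsmult_minus: "nsmult n (- a) = - nsmult n a" for a :: "'v::ab_group_add"
  by (induction n) auto

lemma nsmult_strict_mono:
  "0 < n \<Longrightarrow> a < b \<Longrightarrow> nsmult n a < nsmult n b" for a b :: "'v::linordered_ab_group_add"
proof (induction n)
  case (Suc n)
  then show ?case
    by (cases "n = 0") (auto intro: add_strict_mono)
qed simp

lemma nsmult_le_iff:
  "0 < n \<Longrightarrow> nsmult n a \<le> nsmult n b \<longleftrightarrow> a \<le> b" for a b :: "'v::linordered_ab_group_add"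
  by (metis linorder_not_less nsmult_strict_mono order_le_less)

lemma nsmult_eq_iff:
  "0 < n \<Longrightarrow> nsmult n a = nsmult n b \<longleftrightarrow> a = b" for a b :: "'v::linordered_ab_group_add"
  by (metis linorder_neq_iff nsmult_strict_mono)

text \<open>
  A linearly ordered abelian group \<open>\<Lambda>\<close> is torsion-free, and \<open>\<Lambda> \<otimes> \<rat>\<close> is its group of
  fractions \<open>a/n\<close> with \<open>n > 0\<close>, where \<open>a/m = b/n\<close> iff \<open>n a = m b\<close>.
\<close>

definition hullrel :: "'v::linordered_ab_group_add \<times> nat \<Rightarrow> 'v \<times> nat \<Rightarrow> bool" where
  "hullrel x y \<longleftrightarrow>
    0 < snd x \<and> 0 < snd y \<and> nsmult (snd y) (fst x) = nsmult (snd x) (fst y)"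

lemma part_equivp_hullrel: "part_equivp hullrel"
proof (rule part_equivpI)
  show "\<exists>x. hullrel x x"
    by (rule exI [of _ "(0, 1)"]) (simp add: hullrel_def)
  show "symp hullrel"
    by (auto simp: symp_def hullrel_def)
  show "transp hullrel"
  proof (rule transpI)
    fix x y z :: "'v::linordered_ab_group_add \<times> nat"
    assume xy: "hullrel x y" and yz: "hullrel y z"
    have "nsmult (snd y) (nsmult (snd z) (fst x)) = nsmult (snd z) (nsmult (snd x) (fst y))"
      using xy by (metis hullrel_def nsmult_commute)
    also have "\<dots> = nsmult (snd y) (nsmult (snd x) (fst z))"
      using yz by (metis hullrel_def nsmult_commute)
    finally show "hullrel x z"
      using xy yz by (simp add: hullrel_def nsmult_eq_iff)
  qed
qed

quotient_type (overloaded) 'v divisible_hull =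
  "'v::linordered_ab_group_add \<times> nat" / partial: hullrel
  by (rule part_equivp_hullrel)

lift_definition hull_frac :: "'v::linordered_ab_group_add \<Rightarrow> nat \<Rightarrow> 'v divisible_hull"
  is "\<lambda>a n. if n = 0 then (0, 1) else (a, n)"
  by (simp add: hullrel_def)

lemma nsmult_cross_add:
  assumes "nsmult n a = nsmult m b" "nsmult n' a' = nsmult m' b'"
  shows "nsmult (n * n') (nsmult m' a + nsmult m a') = nsmult (m * m') (nsmult n' b + nsmult n b')"
proof -
  have "nsmult (n * n') (nsmult m' a) = nsmult (n' * m') (nsmult n a)"
    by (simp add: mult.commute mult.left_commute flip: nsmult_mult)
  also have "\<dots> = nsmult (m * m') (nsmult n' b)"
    by (simp add: assms mult.commute mult.left_commute flip: nsmult_mult)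
  finally have 1: "nsmult (n * n') (nsmult m' a) = nsmult (m * m') (nsmult n' b)" .
  have "nsmult (n * n') (nsmult m a') = nsmult (n * m) (nsmult n' a')"
    by (simp add: mult.commute mult.left_commute flip: nsmult_mult)
  also have "\<dots> = nsmult (m * m') (nsmult n b')"
    by (simp add: assms mult.commute mult.left_commute flip: nsmult_mult)
  finally show ?thesis
    using 1 by (simp add: nsmult_add)
qed

lemma nsmult_cross_le:
  fixes a b a' b' :: "'v::linordered_ab_group_add"
  assumes pos: "0 < m" "0 < n" "0 < m'" "0 < n'"
    and eq: "nsmult n a = nsmult m b" "nsmult n' a' = nsmult m' b'"
  shows "nsmult m' a \<le> nsmult m a' \<longleftrightarrow> nsmult n' b \<le> nsmult n b'"
proof -
  have "nsmult m' a \<le> nsmult m a' \<longleftrightarrow>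
      nsmult (n * n') (nsmult m' a) \<le> nsmult (n * n') (nsmult m a')"
    using pos by (simp add: nsmult_le_iff)
  also have "nsmult (n * n') (nsmult m' a) = nsmult (n' * m') (nsmult n a)"
    by (simp add: mult.commute mult.left_commute flip: nsmult_mult)
  also have "\<dots> = nsmult (m * m') (nsmult n' b)"
    by (simp add: eq mult.commute mult.left_commute flip: nsmult_mult)
  also have "nsmult (n * n') (nsmult m a') = nsmult (n * m) (nsmult n' a')"
    by (simp add: mult.commute mult.left_commute flip: nsmult_mult)
  also have "\<dots> = nsmult (m * m') (nsmult n b')"
    by (simp add: eq mult.commute mult.left_commute flip: nsmult_mult)
  finally show ?thesis
    using pos by (simp add: nsmult_le_iff)
qed

instantiation divisible_hull :: (linordered_ab_group_add) linordered_ab_group_add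
begin

lift_definition zero_divisible_hull :: "'a divisible_hull" is "(0, 1)"
  by (simp add: hullrel_def)

lift_definition plus_divisible_hull ::
    "'a divisible_hull \<Rightarrow> 'a divisible_hull \<Rightarrow> 'a divisible_hull"
  is "\<lambda>x y. (nsmult (snd y) (fst x) + nsmult (snd x) (fst y), snd x * snd y)"
  by (auto simp: hullrel_def intro!: nsmult_cross_add)

lift_definition uminus_divisible_hull :: "'a divisible_hull \<Rightarrow> 'a divisible_hull"
  is "\<lambda>x. (- fst x, snd x)"
  by (auto simp: hullrel_def nsmult_minus)

definition minus_divisible_hull ::
    "'a divisible_hull \<Rightarrow> 'a divisible_hull \<Rightarrow> 'a divisible_hull" where
  "x - y = x + - (y :: 'a divisible_hull)"

lift_definition less_eq_divisible_hull :: "'a divisible_hull \<Rightarrow> 'a divisible_hull \<Rightarrow> bool"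
  is "\<lambda>x y. nsmult (snd y) (fst x) \<le> nsmult (snd x) (fst y)"
  by (simp add: hullrel_def nsmult_cross_le)

definition less_divisible_hull :: "'a divisible_hull \<Rightarrow> 'a divisible_hull \<Rightarrow> bool" where
  "x < y \<longleftrightarrow> x \<le> y \<and> \<not> y \<le> (x :: 'a divisible_hull)"

instance
proof
  fix x y z :: "'a divisible_hull"
  show "x + y + z = x + (y + z)"
    by transfer (auto simp: hullrel_def nsmult_add ac_simps simp flip: nsmult_mult)
  show "x + y = y + x"
    by transfer (auto simp: hullrel_def ac_simps)
  show "0 + x = x"
    by transfer (auto simp: hullrel_def)
  show "- x + x = 0"
    by transfer (auto simp: hullrel_def nsmult_minus)
  show "x - y = x + - y"
    by (rule minus_divisible_hull_def)
  show "x < y \<longleftrightarrow> x \<le> y \<and> \<not> y \<le> x"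
    by (rule less_divisible_hull_def)
  show "x \<le> x"
    by transfer auto
  show "x \<le> y \<or> y \<le> x"
    by transfer auto
  show "x \<le> y \<Longrightarrow> y \<le> x \<Longrightarrow> x = y"
    by transfer (auto simp: hullrel_def)
  show "x \<le> y \<Longrightarrow> y \<le> z \<Longrightarrow> x \<le> z"
  proof transfer
    fix x y z :: "'a \<times> nat"
    assume "hullrel x x" "hullrel y y" "hullrel z z"
    then have pos: "0 < snd x" "0 < snd y" "0 < snd z"
      by (auto simp: hullrel_def)
    assume le: "nsmult (snd y) (fst x) \<le> nsmult (snd x) (fst y)"
      "nsmult (snd z) (fst y) \<le> nsmult (snd y) (fst z)"
    have "nsmult (snd y) (nsmult (snd z) (fst x)) = nsmult (snd z) (nsmult (snd y) (fst x))"
      by (rule nsmult_commute)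
    also have "\<dots> \<le> nsmult (snd z) (nsmult (snd x) (fst y))"
      using le pos by (simp add: nsmult_le_iff)
    also have "\<dots> = nsmult (snd x) (nsmult (snd z) (fst y))"
      by (rule nsmult_commute)
    also have "\<dots> \<le> nsmult (snd x) (nsmult (snd y) (fst z))"
      using le pos by (simp add: nsmult_le_iff)
    also have "\<dots> = nsmult (snd y) (nsmult (snd x) (fst z))"
      by (rule nsmult_commute)
    finally show "nsmult (snd z) (fst x) \<le> nsmult (snd x) (fst z)"
      using pos by (simp add: nsmult_le_iff)
  qed
  show "x \<le> y \<Longrightarrow> z + x \<le> z + y"
  proof transfer
    fix x y z :: "'a \<times> nat"
    assume "hullrel x x" "hullrel y y" "hullrel z z"
    then have pos: "0 < snd z"
      by (auto simp: hullrel_def)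
    assume "nsmult (snd y) (fst x) \<le> nsmult (snd x) (fst y)"
    then have "nsmult (snd z * snd z) (nsmult (snd y) (fst x)) \<le>
        nsmult (snd z * snd z) (nsmult (snd x) (fst y))"
      using pos by (simp add: nsmult_le_iff)
    then show "nsmult (snd (nsmult (snd y) (fst z) + nsmult (snd z) (fst y), snd z * snd y))
        (fst (nsmult (snd x) (fst z) + nsmult (snd z) (fst x), snd z * snd x)) \<le>
      nsmult (snd (nsmult (snd x) (fst z) + nsmult (snd z) (fst x), snd z * snd x))
        (fst (nsmult (snd y) (fst z) + nsmult (snd z) (fst y), snd z * snd y))"
      by (simp add: nsmult_add ac_simps flip: nsmult_mult)
  qed
qed

end

lemma hull_frac_le_iff:
  "0 < m \<Longrightarrow> 0 < n \<Longrightarrow> hull_frac a m \<le> hull_frac b n \<longleftrightarrow> nsmult n a \<le> nsmult m b"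
  by transfer auto

lemma hull_frac_eq_iff:
  "0 < m \<Longrightarrow> 0 < n \<Longrightarrow> hull_frac a m = hull_frac b n \<longleftrightarrow> nsmult n a = nsmult m b"
  by transfer (auto simp: hullrel_def)

lemma nsmult_hull_frac: "0 < n \<Longrightarrow> nsmult n (hull_frac a n) = hull_frac a 1"
proof -
  assume n: "0 < n"
  have "nsmult k (hull_frac a n) = hull_frac (nsmult k a) n" for k
  proof (induction k)
    case 0
    then show ?case using n by (simp, transfer) (auto simp: hullrel_def)
  next
    case (Suc k)
    show ?case
      unfolding nsmult.simps Suc using n
      by transfer (auto simp: hullrel_def nsmult_add ac_simps simp flip: nsmult_mult)
  qed
  then show ?thesis
    using n by (simp add: hull_frac_eq_iff)
qed


section \<open>Valuations on polynomial rings\<close>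

definition field_valuation :: "('a::field \<Rightarrow> 'v::linordered_ab_group_add extval) \<Rightarrow> bool" where
  "field_valuation v \<longleftrightarrow>
    (\<forall>a b. v (a * b) = v a + v b) \<and>
    (\<forall>a b. v (a + b) \<ge> min (v a) (v b)) \<and>
    (\<forall>a. v a = Infty \<longleftrightarrow> a = 0)"

definition poly_valuation :: "('a::field poly \<Rightarrow> 'v::linordered_ab_group_add extval) \<Rightarrow> bool" where
  "poly_valuation \<nu> \<longleftrightarrow>
    (\<forall>f g. \<nu> (f * g) = \<nu> f + \<nu> g) \<and>
    (\<forall>f g. \<nu> (f + g) \<ge> min (\<nu> f) (\<nu> g)) \<and>
    field_valuation (\<lambda>a. \<nu> [:a:])"

definition value_group :: "('a::field poly \<Rightarrow> 'v::linordered_ab_group_add extval) \<Rightarrow> 'v set" where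
  "value_group \<nu> = generate \<lparr>carrier = UNIV, mult = (+), one = 0\<rparr> {\<alpha>. \<exists>f. \<nu> f = Fin \<alpha>}"


section \<open>The graded algebra\<close>

definition val_ge :: "('a::field poly \<Rightarrow> 'v::linordered_ab_group_add extval) \<Rightarrow> 'v \<Rightarrow> 'a poly set" where
  "val_ge \<nu> \<alpha> = {g. \<nu> g \<ge> Fin \<alpha>}"

definition val_gt :: "('a::field poly \<Rightarrow> 'v::linordered_ab_group_add extval) \<Rightarrow> 'v \<Rightarrow> 'a poly set" where
  "val_gt \<nu> \<alpha> = {g. \<nu> g > Fin \<alpha>}"

definition val_ge_group ::
    "('a::field poly \<Rightarrow> 'v::linordered_ab_group_add extval) \<Rightarrow> 'v \<Rightarrow> 'a poly monoid" where
  "val_ge_group \<nu> \<alpha> = \<lparr>carrier = val_ge \<nu> \<alpha>, mult = (+), one = 0\<rparr>"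

definition graded_piece ::
    "('a::field poly \<Rightarrow> 'v::linordered_ab_group_add extval) \<Rightarrow> 'v \<Rightarrow> 'a poly set monoid" where
  "graded_piece \<nu> \<alpha> = val_ge_group \<nu> \<alpha> Mod val_gt \<nu> \<alpha>"

definition in_class ::
    "('a::field poly \<Rightarrow> 'v::linordered_ab_group_add extval) \<Rightarrow> 'v \<Rightarrow> 'a poly \<Rightarrow> 'a poly set" where
  "in_class \<nu> \<alpha> g = val_gt \<nu> \<alpha> #>\<^bsub>val_ge_group \<nu> \<alpha>\<^esub> g"

text \<open>
  The product of \<open>A\<close> in degree \<open>\<alpha>\<close> and \<open>B\<close> in degree \<open>\<beta>\<close>: all products of representatives lie
  in one coset, and the union is that coset.
\<close>

definition piece_mult ::
    "('a::field poly \<Rightarrow> 'v::linordered_ab_group_add extval) \<Rightarrow> 'v \<Rightarrow> 'v \<Rightarrow>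
      'a poly set \<Rightarrow> 'a poly set \<Rightarrow> 'a poly set" where
  "piece_mult \<nu> \<alpha> \<beta> A B = (\<Union>f\<in>A. \<Union>g\<in>B. in_class \<nu> (\<alpha> + \<beta>) (f * g))"

definition homogeneous ::
    "('a::field poly \<Rightarrow> 'v::linordered_ab_group_add extval) \<Rightarrow> 'v \<Rightarrow> 'a poly set \<Rightarrow>
      'v \<Rightarrow> 'a poly set" where
  "homogeneous \<nu> \<alpha> A =
    (\<lambda>\<beta>\<in>value_group \<nu>. if \<beta> = \<alpha> then A else \<one>\<^bsub>graded_piece \<nu> \<beta>\<^esub>)"

text \<open>
  The graded pieces are written multiplicatively, as HOL-Algebra groups. The index set of the
  product in \<open>mult\<close> is cut down to the finite supports because \<open>finprod\<close> is trivial on infinite sets.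
\<close>

definition graded_algebra ::
    "('a::field poly \<Rightarrow> 'v::linordered_ab_group_add extval) \<Rightarrow> ('v \<Rightarrow> 'a poly set) ring" where
  "graded_algebra \<nu> =
    \<lparr>carrier = carrier (sum_group (value_group \<nu>) (graded_piece \<nu>)),
     mult = (\<lambda>F G. \<lambda>\<gamma>\<in>value_group \<nu>.
       finprod (graded_piece \<nu> \<gamma>)
         (\<lambda>\<alpha>. piece_mult \<nu> \<alpha> (\<gamma> - \<alpha>) (F \<alpha>) (G (\<gamma> - \<alpha>)))
         {\<alpha> \<in> value_group \<nu>. F \<alpha> \<noteq> \<one>\<^bsub>graded_piece \<nu> \<alpha>\<^esub> \<and>
            G (\<gamma> - \<alpha>) \<noteq> \<one>\<^bsub>graded_piece \<nu> (\<gamma> - \<alpha>)\<^esub>}),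
     one = homogeneous \<nu> 0 (in_class \<nu> 0 1),
     zero = \<one>\<^bsub>sum_group (value_group \<nu>) (graded_piece \<nu>)\<^esub>,
     add = (\<otimes>\<^bsub>sum_group (value_group \<nu>) (graded_piece \<nu>)\<^esub>)\<rparr>"

definition initial_form ::
    "('a::field poly \<Rightarrow> 'v::linordered_ab_group_add extval) \<Rightarrow> 'a poly \<Rightarrow> 'v \<Rightarrow> 'a poly set" where
  "initial_form \<nu> g =
    (case \<nu> g of
       Fin \<alpha> \<Rightarrow> homogeneous \<nu> \<alpha> (in_class \<nu> \<alpha> g)
     | Infty \<Rightarrow> \<zero>\<^bsub>graded_algebra \<nu>\<^esub>)"


section \<open>MacLane-Vaquie key polynomials\<close>

definition val_divides ::
    "('a::field poly \<Rightarrow> 'v::linordered_ab_group_add extval) \<Rightarrow> 'a poly \<Rightarrow> 'a poly \<Rightarrow> bool" where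
  "val_divides \<nu> h g \<longleftrightarrow>
    initial_form \<nu> h divides\<^bsub>graded_algebra \<nu>\<^esub> initial_form \<nu> g"

definition MLV_key_polynomials ::
    "('a::field poly \<Rightarrow> 'v::linordered_ab_group_add extval) \<Rightarrow> 'a poly set" where
  "MLV_key_polynomials \<nu> =
    {g. lead_coeff g = 1 \<and>
        primeideal (PIdl\<^bsub>graded_algebra \<nu>\<^esub> (initial_form \<nu> g)) (graded_algebra \<nu>) \<and>
        PIdl\<^bsub>graded_algebra \<nu>\<^esub> (initial_form \<nu> g) \<noteq> {\<zero>\<^bsub>graded_algebra \<nu>\<^esub>} \<and>
        (\<forall>f. f \<noteq> 0 \<and> degree f < degree g \<longrightarrow> \<not> val_divides \<nu> g f)}"

definition val_degree :: "('a::field poly \<Rightarrow> 'v::linordered_ab_group_add extval) \<Rightarrow> nat" where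
  "val_degree \<nu> = (LEAST d. \<exists>g\<in>MLV_key_polynomials \<nu>. degree g = d)"


section \<open>Truncations\<close>

text \<open>
  An expansion \<open>f = \<Sum>\<^sub>s a\<^sub>s Q\<^sup>s\<close> is encoded as the polynomial over \<open>K[x]\<close> with coefficients \<open>a\<^sub>s\<close>.
\<close>

definition is_expansion :: "'a::field poly \<Rightarrow> 'a poly \<Rightarrow> 'a poly poly \<Rightarrow> bool" where
  "is_expansion Q f A \<longleftrightarrow> f = poly A Q \<and> (\<forall>s. degree (coeff A s) < degree Q)"

lemma ex1_expansion:
  assumes "0 < degree Q"
  shows "\<exists>!A. is_expansion Q f A"
proof (induction "degree f" arbitrary: f rule: less_induct)
  case less
  have Q: "Q \<noteq> 0"
    using assms by auto
  have coeffs: "(\<forall>s. degree (coeff (pCons r B) s) < degree Q) \<longleftrightarrow>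
      degree r < degree Q \<and> (\<forall>s. degree (coeff B s) < degree Q)" 
    for r and B :: "'a poly poly"
  proof
    assume A: "\<forall>s. degree (coeff (pCons r B) s) < degree Q"
    show "degree r < degree Q \<and> (\<forall>s. degree (coeff B s) < degree Q)"
      using spec [OF A, of 0] spec [OF A, of "Suc _"] by simp
  qed (auto simp: coeff_pCons split: nat.split)
  have step: "is_expansion Q g (pCons r B) \<longleftrightarrow> r = g mod Q \<and> is_expansion Q (g div Q) B" for g r B
  proof
    assume A: "is_expansion Q g (pCons r B)"
    then have r: "degree r < degree Q" and B: "\<forall>s. degree (coeff B s) < degree Q"
      and g: "g = r + Q * poly B Q"
      by (auto simp only: is_expansion_def coeffs poly_pCons)
    have "g mod Q = r"
      unfolding g using r by (simp add: mod_poly_less)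
    moreover have "g div Q = poly B Q"
      unfolding g using r Q by (simp add: div_poly_less)
    ultimately show "r = g mod Q \<and> is_expansion Q (g div Q) B"
      using B by (simp add: is_expansion_def)
  next
    assume A: "r = g mod Q \<and> is_expansion Q (g div Q) B"
    then have B: "\<forall>s. degree (coeff B s) < degree Q" and r: "r = g mod Q" and g: "poly B Q = g div Q"
      by (auto simp: is_expansion_def)
    have "degree r < degree Q"
      using assms degree_mod_less [OF Q, of g] r by auto
    moreover have "g = r + Q * poly B Q"
      using r g by simp
    ultimately show "is_expansion Q g (pCons r B)"
      using B unfolding is_expansion_def coeffs poly_pCons by blast
  qed
  have "\<exists>!B. is_expansion Q (f div Q) B"
  proof (cases "degree f < degree Q")
    case True
    have "B = 0" if "is_expansion Q 0 B" for B
      using that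
    proof (induction B)
      case (pCons r B)
      have "r = 0" "is_expansion Q 0 B"
        using step [of 0 r B] pCons.prems by auto
      then show ?case
        using pCons.IH by simp
    qed simp
    moreover have "is_expansion Q 0 0"
      using assms by (simp add: is_expansion_def)
    ultimately have "\<exists>!B. is_expansion Q 0 B"
      by blast
    then show ?thesis
      using True by (simp add: div_poly_less)
  next
    case False
    have "degree (f div Q) < degree f"
      using False assms by (simp add: degree_div_less)
    then show ?thesis
      by (rule less)
  qed
  then obtain B where B: "is_expansion Q (f div Q) B" "\<And>B'. is_expansion Q (f div Q) B' \<Longrightarrow> B' = B"
    by blast
  show ?case
  proof
    show "is_expansion Q f (pCons (f mod Q) B)"
      using B(1) step [of f "f mod Q" B] by simp
    show "A = pCons (f mod Q) B" if A: "is_expansion Q f A" for A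
    proof -
      obtain r B' where A': "A = pCons r B'"
        by (rule pCons_cases)
      then have "r = f mod Q" "is_expansion Q (f div Q) B'"
        using A step [of f r B'] by simp_all
      then show ?thesis
        using A' B(2) [of B'] by simp
    qed
  qed
qed

definition expansion :: "'a::field poly \<Rightarrow> 'a poly \<Rightarrow> 'a poly poly" where
  "expansion Q f = (THE A. is_expansion Q f A)"

lemma is_expansion_expansion: "0 < degree Q \<Longrightarrow> is_expansion Q f (expansion Q f)"
  unfolding expansion_def by (rule theI') (rule ex1_expansion)

definition truncation ::
    "('a::field poly \<Rightarrow> 'v::linordered_ab_group_add extval) \<Rightarrow> 'a poly \<Rightarrow> 'a poly \<Rightarrow> 'v extval" where
  "truncation \<nu> Q f =
    Min ((\<lambda>s. \<nu> (coeff (expansion Q f) s * Q ^ s)) ` {..degree (expansion Q f)})"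


section \<open>Abstract key polynomials\<close>

text \<open>
  The polynomial \<open>f(x + y)\<close>, with \<open>y\<close> as the outer variable and \<open>K[x]\<close> as coefficient ring.
\<close>

definition poly_x_plus_y :: "'a::field poly \<Rightarrow> 'a poly poly" where
  "poly_x_plus_y f = pcompose (map_poly (\<lambda>a. [:a:]) f) [:[:0, 1:], 1:]"

definition hasse_deriv :: "nat \<Rightarrow> 'a::field poly \<Rightarrow> 'a poly" where
  "hasse_deriv b f = coeff (poly_x_plus_y f) b"

text \<open>
  Only those \<open>b\<close> with \<open>\<nu> (\<partial>\<^sub>b f) < \<infinity>\<close> compete for the maximum, the other quotients being \<open>-\<infinity>\<close>.
  For non-constant \<open>f\<close> there are finitely many of them, and \<open>b = degree f\<close> is one.
\<close>

definition epsilon ::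
    "('a::field poly \<Rightarrow> 'v::linordered_ab_group_add extval) \<Rightarrow> 'a poly \<Rightarrow>
      'v divisible_hull extval" where
  "epsilon \<nu> f =
    (case \<nu> f of
       Infty \<Rightarrow> Infty
     | Fin \<alpha> \<Rightarrow> Fin (Max {hull_frac (\<alpha> - \<beta>) b | b \<beta>. 1 \<le> b \<and> \<nu> (hasse_deriv b f) = Fin \<beta>}))"

definition key_polynomial ::
    "('a::field poly \<Rightarrow> 'v::linordered_ab_group_add extval) \<Rightarrow> 'a poly \<Rightarrow> bool" where
  "key_polynomial \<nu> Q \<longleftrightarrow>
    lead_coeff Q = 1 \<and> 0 < degree Q \<and>
    (\<forall>f. 0 < degree f \<and> degree f < degree Q \<longrightarrow> epsilon \<nu> f < epsilon \<nu> Q)"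

end

theory Submission
  imports Defs
begin

text \<open>
  The proof replaces the quotients in the definition of \<open>\<epsilon>\<close> by Gauss valuations. For a weight \<open>\<delta>\<close>
  in the divisible hull let \<open>w\<close> be the valuation on \<open>K[x][y]\<close> that extends \<open>\<nu>\<close> and gives the value
  \<open>min\<^sub>b (\<nu>(g\<^sub>b) + b \<delta>)\<close> to \<open>\<Sum>\<^sub>b g\<^sub>b y\<^sup>b\<close>. Since the coefficients of \<open>f(x + y)\<close> in \<open>y\<close> are the \<open>\<partial>\<^sub>b f\<close>, one has
  \<open>\<epsilon>(f) \<le> \<delta>\<close> iff \<open>w(f(x + y)) = \<nu>(f)\<close>, and \<open>\<epsilon>(f) < \<delta>\<close> iff in addition the initial form of
  \<open>f(x + y)\<close> does not involve \<open>y\<close>. As \<open>f \<mapsto> f(x + y)\<close> is a ring homomorphism and \<open>w\<close> is a valuation,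
  both conditions are stable under products.

  The main consequence concerns \<open>f = r + Q h\<close> where \<open>\<epsilon>(Q) = \<delta>\<close> and \<open>\<epsilon>(r) < \<delta>\<close>: the initial form of
  \<open>(Q h)(x + y)\<close> involves \<open>y\<close>, that of \<open>r(x + y)\<close> does not, so they cannot cancel. Hence
  \<open>\<nu>(f) = min (\<nu>(r), \<nu>(Q h))\<close> if \<open>\<epsilon>(f) \<le> \<delta>\<close>, and \<open>\<nu>(r) < \<nu>(Q h)\<close> if \<open>\<epsilon>(f) < \<delta>\<close>
  (\<open>no_cancellation_remainder\<close> and \<open>dominant_remainder\<close>).

  On the side of the graded algebra, a MacLane-Vaquie key polynomial \<open>\<phi>\<close> satisfies
  \<open>\<nu>(f) \<le> \<nu>(f mod \<phi>)\<close> for all \<open>f\<close>, because otherwise the initial form of \<open>f mod \<phi>\<close> would be divisible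
  by that of \<open>\<phi>\<close> (\<open>MLV_key_polynomial_val_minimal\<close>). Iterating this along the \<open>\<phi>\<close>-expansion gives
  \<open>\<nu>\<^sub>\<phi> = \<nu>\<close>. Moreover \<open>\<epsilon>(\<phi>)\<close> is then the largest value of \<open>\<epsilon>\<close> (\<open>epsilon_le_val_minimal\<close>): if \<open>Q\<close> is of
  least degree with \<open>\<epsilon>(Q) > \<epsilon>(\<phi>)\<close>, then \<open>\<phi>\<close> has the initial form of \<open>\<phi> mod Q\<close>, which contradicts the
  minimality of \<open>\<phi>\<close> if \<open>deg Q < deg \<phi>\<close>; in degrees from \<open>deg \<phi>\<close> on, the bound is inherited from the
  quotient and the remainder modulo \<open>\<phi>\<close>.

  So all elements of \<open>KP(\<nu>)\<close> have the same \<open>\<epsilon>\<close>, and if one of them is a key polynomial, then none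
  has smaller degree. Conversely, if \<open>\<phi>\<close> is not a key polynomial, there is a key polynomial
  \<open>Q\<close> of smaller degree with the same, maximal \<open>\<epsilon>\<close> (\<open>smaller_key_polynomial_exists\<close>). The main
  consequence above then shows \<open>\<nu>(f) \<le> \<nu>(f mod Q)\<close> for all \<open>f\<close>, and \<open>\<nu>(f g mod Q) = \<nu>(f g)\<close> for
  \<open>f\<close>, \<open>g\<close> of degree below \<open>deg Q\<close>; these two facts say that the initial form of \<open>Q\<close> generates a prime ideal
  (\<open>MLV_key_polynomialI\<close>). So \<open>Q \<in> KP(\<nu>)\<close>, and \<open>deg \<phi>\<close> is not minimal.
\<close>

section \<open>Arithmetic of extended values\<close>

instance extval :: (linordered_ab_group_add) ordered_comm_monoid_add
proof
  fix x y z :: "'a extval"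
  show "x \<le> y \<Longrightarrow> z + x \<le> z + y"
    by (cases x; cases y; cases z) auto
qed

lemma extval_add_Infty [simp]: "x + Infty = (Infty :: 'v::linordered_ab_group_add extval)"
  by (cases x) auto

lemma extval_add_eq_Infty_iff [simp]:
  "x + y = Infty \<longleftrightarrow> x = Infty \<or> y = (Infty :: 'v::linordered_ab_group_add extval)"
  by (cases x; cases y) auto

lemma extval_le_Infty [simp]: "x \<le> (Infty :: 'v::linordered_ab_group_add extval)"
  by (cases x) auto

lemma extval_Infty_le_iff [simp]: "Infty \<le> x \<longleftrightarrow> x = (Infty :: 'v::linordered_ab_group_add extval)"
  by (cases x) auto

lemma extval_add_less_le_mono:
  fixes x y :: "'v::linordered_ab_group_add extval"
  assumes "Fin a < x" "Fin b \<le> y"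
  shows "Fin (a + b) < x + y"
  using assms by (cases x; cases y) (auto intro: add_less_le_mono)

lemma extval_add_le_less_mono:
  fixes x y :: "'v::linordered_ab_group_add extval"
  assumes "Fin a \<le> x" "Fin b < y"
  shows "Fin (a + b) < x + y"
  using extval_add_less_le_mono [OF assms(2,1)] by (simp add: add.commute)

lemma extval_add_mono:
  fixes x y :: "'v::linordered_ab_group_add extval"
  assumes "Fin a \<le> x" "Fin b \<le> y"
  shows "Fin (a + b) \<le> x + y"
  using add_mono [OF assms] by simp


section \<open>Valuations and their Gauss extensions\<close>

locale extended_valuation =
  fixes V :: "'r::comm_ring_1 \<Rightarrow> 'w::linordered_ab_group_add extval"
  assumes val_mult: "V (x * y) = V x + V y"
    and val_add: "min (V x) (V y) \<le> V (x + y)"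
    and val_0 [simp]: "V 0 = Infty"
    and val_1 [simp]: "V 1 = Fin 0"
begin

lemma val_uminus [simp]: "V (- x) = V x"
proof -
  have "V (-1) + V (-1) = Fin 0"
    using val_mult [of "-1" "-1"] by simp
  then have "V (-1) = Fin 0"
    by (cases "V (-1)") auto
  then show ?thesis
    using val_mult [of "-1" x] by (cases "V x") auto
qed

lemma val_diff: "min (V x) (V y) \<le> V (x - y)"
  using val_add [of x "- y"] by simp

lemma val_add_ge: "c \<le> V x \<Longrightarrow> c \<le> V y \<Longrightarrow> c \<le> V (x + y)"
  using val_add [of x y] by (meson min.boundedI order_trans)

lemma val_diff_ge: "c \<le> V x \<Longrightarrow> c \<le> V y \<Longrightarrow> c \<le> V (x - y)"
  using val_diff [of x y] by (meson min.boundedI order_trans)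

lemma val_add_gt: "c < V x \<Longrightarrow> c < V y \<Longrightarrow> c < V (x + y)"
  using val_add [of x y] by (meson min_less_iff_conj order_less_le_trans)

lemma val_diff_gt: "c < V x \<Longrightarrow> c < V y \<Longrightarrow> c < V (x - y)"
  using val_diff [of x y] by (meson min_less_iff_conj order_less_le_trans)

lemma val_add_eq:
  assumes "V x < V y"
  shows "V (x + y) = V x"
proof (rule antisym)
  show "V x \<le> V (x + y)"
    using assms by (intro val_add_ge) auto
  show "V (x + y) \<le> V x"
    using val_diff [of "x + y" y] assms by (auto simp: min_def split: if_splits)
qed

lemma val_sum_ge: "(\<And>i. i \<in> A \<Longrightarrow> c \<le> V (f i)) \<Longrightarrow> c \<le> V (sum f A)"
  by (induction A rule: infinite_finite_induct) (auto intro: val_add_ge)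

lemma val_sum_gt: "(\<And>i. i \<in> A \<Longrightarrow> Fin m < V (f i)) \<Longrightarrow> Fin m < V (sum f A)"
  by (induction A rule: infinite_finite_induct) (auto intro: val_add_gt)

text \<open>
  The value of the term of degree \<open>b\<close> of \<open>P \<in> R[y]\<close> for the Gauss extension of \<open>V\<close> that gives the
  variable \<open>y\<close> the weight \<open>\<delta>\<close>; the Gauss value of \<open>P\<close> is the minimum over \<open>b\<close>.
\<close>

definition weight :: "'w \<Rightarrow> 'r poly \<Rightarrow> nat \<Rightarrow> 'w extval" where
  "weight \<delta> P b = V (coeff P b) + Fin (nsmult b \<delta>)"

text \<open>
  In terms of initial forms: \<open>m\<close> is the Gauss value of \<open>P\<close>, and \<open>d\<close> is the degree in \<open>y\<close> of the
  initial form of \<open>P\<close>.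
\<close>

definition leading :: "'w \<Rightarrow> 'r poly \<Rightarrow> 'w \<Rightarrow> nat \<Rightarrow> bool" where
  "leading \<delta> P m d \<longleftrightarrow>
    (\<forall>b. Fin m \<le> weight \<delta> P b) \<and> weight \<delta> P d = Fin m \<and> (\<forall>b>d. Fin m < weight \<delta> P b)"

lemma weight_0: "weight \<delta> P 0 = V (coeff P 0)"
  by (cases "V (coeff P 0)") (auto simp: weight_def)

lemma weight_add_ge:
  assumes "c \<le> weight \<delta> P b" "c \<le> weight \<delta> P' b"
  shows "c \<le> weight \<delta> (P + P') b"
proof -
  have "min (V (coeff P b)) (V (coeff P' b)) + Fin (nsmult b \<delta>) \<le> weight \<delta> (P + P') b"
    unfolding weight_def coeff_add by (intro add_right_mono val_add)
  moreover have "c \<le> min (V (coeff P b)) (V (coeff P' b)) + Fin (nsmult b \<delta>)"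
    using assms by (auto simp: weight_def min_def)
  ultimately show ?thesis
    by (rule order_trans [rotated])
qed

lemma weight_add_gt:
  assumes "c < weight \<delta> P b" "c < weight \<delta> P' b"
  shows "c < weight \<delta> (P + P') b"
proof -
  have "min (V (coeff P b)) (V (coeff P' b)) + Fin (nsmult b \<delta>) \<le> weight \<delta> (P + P') b"
    unfolding weight_def coeff_add by (intro add_right_mono val_add)
  moreover have "c < min (V (coeff P b)) (V (coeff P' b)) + Fin (nsmult b \<delta>)"
    using assms by (auto simp: weight_def min_def)
  ultimately show ?thesis
    by (rule order_less_le_trans [rotated])
qed

lemma weight_mult_term:
  "i \<le> k \<Longrightarrow> V (coeff P i * coeff P' (k - i)) + Fin (nsmult k \<delta>) = weight \<delta> P i + weight \<delta> P' (k - i)"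
  using nsmult_add_left [of i "k - i" \<delta>]
  by (cases "V (coeff P i)"; cases "V (coeff P' (k - i))") (auto simp: weight_def val_mult ac_simps)

text \<open>One half of Gauss's lemma: every product of terms has at least the expected value.\<close>

lemma weight_mult_ge:
  assumes "\<And>b. Fin m \<le> weight \<delta> P b" "\<And>b. Fin m' \<le> weight \<delta> P' b"
  shows "Fin (m + m') \<le> weight \<delta> (P * P') k"
proof -
  have shift: "Fin (a - c) \<le> x \<longleftrightarrow> Fin a \<le> x + Fin c" for a c :: 'w and x
    by (cases x) (auto simp: algebra_simps)
  have "Fin (m + m' - nsmult k \<delta>) \<le> V (coeff (P * P') k)"
    unfolding coeff_mult
  proof (rule val_sum_ge)
    fix i assume "i \<in> {..k}"
    then show "Fin (m + m' - nsmult k \<delta>) \<le> V (coeff P i * coeff P' (k - i))"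
      unfolding shift using assms by (simp add: weight_mult_term extval_add_mono)
  qed
  then show ?thesis
    unfolding shift by (simp add: weight_def)
qed

text \<open>
  The other half of Gauss's lemma: of all products contributing to the coefficient of index \<open>d + d'\<close>, only the one of
  the two leading terms has the minimal value, hence it cannot be cancelled.
\<close>

lemma leading_mult:
  assumes P: "leading \<delta> P m d" and P': "leading \<delta> P' m' d'"
  shows "leading \<delta> (P * P') (m + m') (d + d')"
proof -
  \<comment> \<open>The bounds are moved to the coefficients, where the valuation inequalities for sums apply.\<close>
  have shift: "Fin (a - c) < x \<longleftrightarrow> Fin a < x + Fin c" "x = Fin (a - c) \<longleftrightarrow> x + Fin c = Fin a"
    for a c :: 'w and x
    by (cases x; auto simp: algebra_simps)+
  have ge: "Fin m \<le> weight \<delta> P b" "Fin m' \<le> weight \<delta> P' b" for b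
    using P P' by (auto simp: leading_def)
  have far: "Fin (m + m' - nsmult k \<delta>) < V (coeff P i * coeff P' (k - i))"
    if "i \<le> k" "d < i \<or> d' < k - i" for i k
    unfolding shift using that P P' ge
    by (auto simp: weight_mult_term leading_def intro: extval_add_less_le_mono extval_add_le_less_mono)
  have gt: "Fin (m + m') < weight \<delta> (P * P') k" if "d + d' < k" for k
  proof -
    have "Fin (m + m' - nsmult k \<delta>) < V (coeff (P * P') k)"
      unfolding coeff_mult using that by (intro val_sum_gt far) auto
    then show ?thesis
      unfolding shift by (simp add: weight_def)
  qed
  have "V (coeff (P * P') (d + d')) = Fin (m + m' - nsmult (d + d') \<delta>)"
  proof -
    let ?k = "d + d'"
    have main: "V (coeff P d * coeff P' d') = Fin (m + m' - nsmult ?k \<delta>)"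
      unfolding shift using weight_mult_term [of d ?k P P' \<delta>] P P' by (simp add: leading_def)
    have "Fin (m + m' - nsmult ?k \<delta>) < V (\<Sum>i\<in>{..?k} - {d}. coeff P i * coeff P' (?k - i))"
      by (intro val_sum_gt far) auto
    then have "V (coeff P d * coeff P' d' + (\<Sum>i\<in>{..?k} - {d}. coeff P i * coeff P' (?k - i)))
        = Fin (m + m' - nsmult ?k \<delta>)"
      by (subst val_add_eq) (simp_all add: main)
    moreover have "coeff (P * P') ?k =
        coeff P d * coeff P' d' + (\<Sum>i\<in>{..?k} - {d}. coeff P i * coeff P' (?k - i))"
      unfolding coeff_mult by (subst sum.remove [of _ d]) auto
    ultimately show ?thesis
      by simp
  qed
  then have "weight \<delta> (P * P') (d + d') = Fin (m + m')"
    by (simp add: shift weight_def)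
  then show ?thesis
    using gt weight_mult_ge [OF ge] by (auto simp: leading_def)
qed

lemma leading_add_dominant:
  assumes P: "leading \<delta> P m d"
    and P': "\<And>b. Fin m \<le> weight \<delta> P' b" "\<And>b. d \<le> b \<Longrightarrow> Fin m < weight \<delta> P' b"
  shows "leading \<delta> (P + P') m d"
proof -
  have shift: "V x + Fin c = Fin a \<longleftrightarrow> V x = Fin (a - c)" "Fin a < V x + Fin c \<longleftrightarrow> Fin (a - c) < V x"
    for a c :: 'w and x
    by (cases "V x"; auto simp: algebra_simps)+
  have "V (coeff P d) < V (coeff P' d)" "V (coeff P d) = Fin (m - nsmult d \<delta>)"
    using P P'(2) [of d] by (auto simp: leading_def weight_def shift)
  then have "weight \<delta> (P + P') d = Fin m"
    by (simp add: weight_def val_add_eq)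
  then show ?thesis
    using P P' by (auto simp: leading_def intro: weight_add_ge weight_add_gt)
qed

lemma leading_exists:
  assumes "V (coeff P 0) \<noteq> Infty"
  obtains m d where "leading \<delta> P m d"
proof -
  define M where "M = Min (weight \<delta> P ` {..degree P})"
  have out: "weight \<delta> P b = Infty" if "degree P < b" for b
    using that by (simp add: weight_def coeff_eq_0)
  have M: "M \<le> weight \<delta> P b" for b
    by (cases "degree P < b") (auto simp: out M_def)
  then have "M \<noteq> Infty"
    using M [of 0] assms by (auto simp: weight_0)
  then obtain m where m: "M = Fin m"
    by (cases M) auto
  define D where "D = {b. weight \<delta> P b = Fin m}"
  have "D \<subseteq> {..degree P}"
  proof
    fix b assume "b \<in> D"
    then show "b \<in> {..degree P}"
      using out [of b] by (cases "degree P < b") (auto simp: D_def)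
  qed
  then have fin: "finite D"
    using finite_subset by auto
  have "M \<in> weight \<delta> P ` {..degree P}"
    unfolding M_def by (intro Min_in) auto
  then have "D \<noteq> {}"
    by (auto simp: D_def m)
  then have "Max D \<in> D"
    using fin by (rule Max_in [rotated])
  then have top: "weight \<delta> P (Max D) = Fin m"
    by (simp add: D_def)
  have above: "Fin m < weight \<delta> P b" if "Max D < b" for b
  proof -
    have "b \<notin> D"
      using fin that by (meson Max_ge leD)
    then have "weight \<delta> P b \<noteq> Fin m"
      by (simp add: D_def)
    then show ?thesis
      using M [of b] unfolding m by (simp add: order_less_le)
  qed
  have "leading \<delta> P m (Max D)"
    unfolding leading_def using M top above unfolding m by blast
  then show ?thesis
    by (rule that)
qed

end


section \<open>Taylor expansions\<close>

lemma poly_x_plus_y_mult: "poly_x_plus_y (f * g) = poly_x_plus_y f * poly_x_plus_y g"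
proof -
  have hom: "map_poly (\<lambda>a. [:a:]) (p * q) = map_poly (\<lambda>a. [:a:]) p * map_poly (\<lambda>a. [:a:]) q"
    for p q :: "'a poly"
  proof (rule poly_eqI)
    fix n
    show "coeff (map_poly (\<lambda>a. [:a:]) (p * q)) n =
        coeff (map_poly (\<lambda>a. [:a:]) p * map_poly (\<lambda>a. [:a:]) q) n"
      by (simp add: coeff_map_poly coeff_mult mult.commute flip: sum_to_poly)
  qed
  show ?thesis
    unfolding poly_x_plus_y_def hom pcompose_mult by (rule refl)
qed

lemma poly_x_plus_y_add: "poly_x_plus_y (f + g) = poly_x_plus_y f + poly_x_plus_y g"
proof -
  have "map_poly (\<lambda>a. [:a:]) (f + g) = map_poly (\<lambda>a. [:a:]) f + map_poly (\<lambda>a. [:a:]) g"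
    by (rule poly_eqI) (simp add: coeff_map_poly)
  then show ?thesis
    by (simp add: poly_x_plus_y_def pcompose_add)
qed

lemma poly_x_plus_y_const [simp]: "poly_x_plus_y [:a:] = [:[:a:]:]"
  by (simp add: poly_x_plus_y_def map_poly_pCons)

lemma poly_x_plus_y_0 [simp]: "poly_x_plus_y 0 = 0"
  by (simp add: poly_x_plus_y_def)

lemma hasse_deriv_0 [simp]: "hasse_deriv 0 f = f"
proof -
  have "poly (map_poly (\<lambda>a. [:a:]) f) [:0, 1:] = f"
    using pcompose_altdef [of f "[:0, 1:]"] by simp
  then show ?thesis
    by (simp add: hasse_deriv_def poly_x_plus_y_def)
qed

lemma degree_poly_x_plus_y [simp]: "degree (poly_x_plus_y f) = degree f"
  by (simp add: poly_x_plus_y_def degree_pcompose degree_map_poly)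

lemma hasse_deriv_eq_0: "degree f < b \<Longrightarrow> hasse_deriv b f = 0"
  by (simp add: hasse_deriv_def coeff_eq_0)

lemma hasse_deriv_degree: "hasse_deriv (degree f) f = [:lead_coeff f:]"
proof -
  have "coeff (poly_x_plus_y f) (degree (poly_x_plus_y f)) = [:lead_coeff f:]"
    unfolding poly_x_plus_y_def by (subst lead_coeff_comp) (auto simp: degree_map_poly coeff_map_poly)
  then show ?thesis
    by (simp add: hasse_deriv_def)
qed


section \<open>Values in the divisible hull\<close>

lemma hull_frac_add: "hull_frac (a + b) 1 = hull_frac a 1 + hull_frac b 1"
  by transfer (simp add: hullrel_def)

lemma hull_frac_zero: "hull_frac 0 1 = 0"
  by transfer (simp add: hullrel_def)

lemma hull_frac_le_int_iff [simp]: "hull_frac a (Suc 0) \<le> hull_frac b (Suc 0) \<longleftrightarrow> a \<le> b"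
  using hull_frac_le_iff [of 1 1 a b] by simp

lemma hull_frac_diff_le_iff:
  assumes "0 < b"
  shows "hull_frac (\<alpha> - \<beta>) b \<le> \<delta> \<longleftrightarrow> hull_frac \<alpha> 1 \<le> hull_frac \<beta> 1 + nsmult b \<delta>"
proof -
  have "hull_frac (\<alpha> - \<beta>) b \<le> \<delta> \<longleftrightarrow> nsmult b (hull_frac (\<alpha> - \<beta>) b) \<le> nsmult b \<delta>"
    using assms by (simp add: nsmult_le_iff)
  also have "nsmult b (hull_frac (\<alpha> - \<beta>) b) = hull_frac (\<alpha> - \<beta>) 1"
    using assms by (rule nsmult_hull_frac)
  also have "\<dots> = hull_frac \<alpha> 1 - hull_frac \<beta> 1"
    using hull_frac_add [of "\<alpha> - \<beta>" \<beta>] by (simp add: algebra_simps)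
  finally show ?thesis
    by (simp add: algebra_simps)
qed

text \<open>
  In the hull, the values of polynomials can be compared with the multiples \<open>b \<delta>\<close> of a weight
  \<open>\<delta> = \<epsilon>(f)\<close>, which need not lie in the original group.
\<close>

definition hull_value ::
    "('a::field poly \<Rightarrow> 'v::linordered_ab_group_add extval) \<Rightarrow> 'a poly \<Rightarrow> 'v divisible_hull extval"
  where "hull_value \<nu> f = map_extval (\<lambda>\<alpha>. hull_frac \<alpha> 1) (\<nu> f)"

lemma hull_value_le_iff [simp]: "hull_value \<nu> f \<le> hull_value \<nu> g \<longleftrightarrow> \<nu> f \<le> \<nu> g"
  by (cases "\<nu> f"; cases "\<nu> g") (auto simp: hull_value_def)

lemma hull_value_less_iff [simp]: "hull_value \<nu> f < hull_value \<nu> g \<longleftrightarrow> \<nu> f < \<nu> g"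
  by (metis hull_value_le_iff not_le)

lemma hull_value_eq_Infty_iff [simp]: "hull_value \<nu> f = Infty \<longleftrightarrow> \<nu> f = Infty"
  by (cases "\<nu> f") (auto simp: hull_value_def)

locale valued_polynomials =
  fixes \<nu> :: "'a::field poly \<Rightarrow> 'v::linordered_ab_group_add extval"
  assumes poly_valuation: "poly_valuation \<nu>"
begin

lemma val_const_finite: "a \<noteq> 0 \<Longrightarrow> \<nu> [:a:] \<noteq> Infty"
  using poly_valuation by (auto simp: poly_valuation_def field_valuation_def)

sublocale extended_valuation \<nu>
proof
  show mult: "\<nu> (f * g) = \<nu> f + \<nu> g" for f g
    using poly_valuation by (auto simp: poly_valuation_def)
  show "min (\<nu> f) (\<nu> g) \<le> \<nu> (f + g)" for f g
    using poly_valuation by (auto simp: poly_valuation_def)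
  have "\<nu> [:0:] = Infty"
    using poly_valuation unfolding poly_valuation_def field_valuation_def by blast
  then show "\<nu> 0 = Infty"
    by simp
  have "\<nu> 1 \<noteq> Infty"
    using val_const_finite [of 1] by (simp add: one_pCons)
  then show "\<nu> 1 = Fin 0"
    using mult [of 1 1] by (cases "\<nu> 1") auto
qed

sublocale hull: extended_valuation "hull_value \<nu>"
proof
  show "hull_value \<nu> (f * g) = hull_value \<nu> f + hull_value \<nu> g" for f g
    by (cases "\<nu> f"; cases "\<nu> g") (simp_all only: hull_value_def val_mult extval.map plus_extval.simps hull_frac_add)
  show "min (hull_value \<nu> f) (hull_value \<nu> g) \<le> hull_value \<nu> (f + g)" for f g
    using val_add [of f g] by (auto simp: min_def)
  show "hull_value \<nu> 0 = Infty"
    by simp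
  show "hull_value \<nu> 1 = Fin 0"
    by (simp only: hull_value_def val_1 extval.map hull_frac_zero)
qed


section \<open>The level of a polynomial as a domination property\<close>

text \<open>
  Let \<open>w\<close> be the Gauss extension of \<open>\<nu>\<close> to \<open>K[x][y]\<close> giving \<open>y\<close> the weight \<open>\<delta>\<close>. Clearing
  denominators in the definition of \<open>\<epsilon>\<close> turns \<open>\<epsilon>(f) \<le> \<delta>\<close> into \<open>w(f(x + y)) = \<nu>(f)\<close>, and
  \<open>\<epsilon>(f) < \<delta>\<close> into the initial form of \<open>f(x + y)\<close> being of degree \<open>0\<close> in \<open>y\<close>. Unlike \<open>\<epsilon>\<close> itself, both
  conditions make sense for constants.
\<close>

definition eps_le :: "'v divisible_hull \<Rightarrow> 'a poly \<Rightarrow> bool" where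
  "eps_le \<delta> f \<longleftrightarrow> (\<forall>b. hull_value \<nu> f \<le> hull.weight \<delta> (poly_x_plus_y f) b)"

definition eps_less :: "'v divisible_hull \<Rightarrow> 'a poly \<Rightarrow> bool" where
  "eps_less \<delta> f \<longleftrightarrow> (\<forall>b\<ge>1. hull_value \<nu> f < hull.weight \<delta> (poly_x_plus_y f) b)"

lemma weight_taylor_0 [simp]: "hull.weight \<delta> (poly_x_plus_y f) 0 = hull_value \<nu> f"
  using hasse_deriv_0 [of f] by (simp add: hull.weight_0 hasse_deriv_def)

lemma eps_less_imp_le: "eps_less \<delta> f \<Longrightarrow> eps_le \<delta> f"
  unfolding eps_less_def eps_le_def
proof
  fix b assume "\<forall>b\<ge>1. hull_value \<nu> f < hull.weight \<delta> (poly_x_plus_y f) b"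
  then show "hull_value \<nu> f \<le> hull.weight \<delta> (poly_x_plus_y f) b"
    by (cases "b = 0") (auto simp: Suc_le_eq intro: less_imp_le)
qed

lemma eps_less_iff_leading:
  assumes "hull_value \<nu> f = Fin m"
  shows "eps_less \<delta> f \<longleftrightarrow> hull.leading \<delta> (poly_x_plus_y f) m 0"
proof
  assume "eps_less \<delta> f"
  then show "hull.leading \<delta> (poly_x_plus_y f) m 0"
    using eps_less_imp_le [of \<delta> f] assms unfolding hull.leading_def eps_less_def eps_le_def by simp
next
  assume "hull.leading \<delta> (poly_x_plus_y f) m 0"
  then show "eps_less \<delta> f"
    using assms by (auto simp: hull.leading_def eps_less_def)
qed

lemma
  assumes deg: "0 < degree f" and fin: "\<nu> f \<noteq> Infty"
  shows epsilon_finite: "\<exists>\<delta>. epsilon \<nu> f = Fin \<delta>"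
    and epsilon_le_iff: "epsilon \<nu> f \<le> Fin \<delta> \<longleftrightarrow> eps_le \<delta> f"
    and epsilon_less_iff: "epsilon \<nu> f < Fin \<delta> \<longleftrightarrow> eps_less \<delta> f"
proof -
  obtain \<alpha> where \<alpha>: "\<nu> f = Fin \<alpha>"
    using fin by (cases "\<nu> f") auto
  let ?S = "{hull_frac (\<alpha> - \<beta>) b | b \<beta>. 1 \<le> b \<and> \<nu> (hasse_deriv b f) = Fin \<beta>}"
  have eps: "epsilon \<nu> f = Fin (Max ?S)"
    by (simp add: epsilon_def \<alpha>)
  then show "\<exists>\<delta>. epsilon \<nu> f = Fin \<delta>"
    by blast
  have "?S \<subseteq> (\<lambda>b. hull_frac (\<alpha> - (case \<nu> (hasse_deriv b f) of Fin \<beta> \<Rightarrow> \<beta>)) b) ` {..degree f}"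
  proof clarify
    fix b \<beta> assume b: "1 \<le> b" "\<nu> (hasse_deriv b f) = Fin \<beta>"
    then have "b \<le> degree f"
      using hasse_deriv_eq_0 [of f b] by (cases "b \<le> degree f") auto
    with b show "hull_frac (\<alpha> - \<beta>) b
        \<in> (\<lambda>b. hull_frac (\<alpha> - (case \<nu> (hasse_deriv b f) of Fin \<beta> \<Rightarrow> \<beta>)) b) ` {..degree f}"
      by (intro image_eqI [of _ _ b]) auto
  qed
  then have finS: "finite ?S"
    by (rule finite_subset) auto
  have "\<nu> (hasse_deriv (degree f) f) \<noteq> Infty"
    unfolding hasse_deriv_degree using deg by (intro val_const_finite) auto
  then obtain \<beta> where "\<nu> (hasse_deriv (degree f) f) = Fin \<beta>"
    by (cases "\<nu> (hasse_deriv (degree f) f)") auto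
  then have "hull_frac (\<alpha> - \<beta>) (degree f) \<in> ?S"
    using deg by force
  then have neS: "?S \<noteq> {}"
    by blast
  have weight: "hull.weight \<delta> (poly_x_plus_y f) b = hull_value \<nu> (hasse_deriv b f) + Fin (nsmult b \<delta>)"
    for b
    by (simp add: hull.weight_def hasse_deriv_def)
  have le: "hull_frac (\<alpha> - \<beta>) b \<le> \<delta> \<longleftrightarrow> hull_value \<nu> f \<le> hull.weight \<delta> (poly_x_plus_y f) b"
    if "1 \<le> b" "\<nu> (hasse_deriv b f) = Fin \<beta>" for b \<beta>
    using that hull_frac_diff_le_iff [of b \<alpha> \<beta> \<delta>] by (simp add: weight hull_value_def \<alpha>)
  have less: "hull_frac (\<alpha> - \<beta>) b < \<delta> \<longleftrightarrow> hull_value \<nu> f < hull.weight \<delta> (poly_x_plus_y f) b"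
    if "1 \<le> b" "\<nu> (hasse_deriv b f) = Fin \<beta>" for b \<beta>
  proof -
    have "hull_frac (\<alpha> - \<beta>) b = \<delta> \<longleftrightarrow> hull_value \<nu> f = hull.weight \<delta> (poly_x_plus_y f) b"
    proof -
      have "hull_frac (\<alpha> - \<beta>) b = \<delta> \<longleftrightarrow> nsmult b (hull_frac (\<alpha> - \<beta>) b) = nsmult b \<delta>"
        using that by (simp add: nsmult_eq_iff)
      also have "nsmult b (hull_frac (\<alpha> - \<beta>) b) = hull_frac (\<alpha> - \<beta>) 1"
        using that by (intro nsmult_hull_frac) simp
      also have "\<dots> = hull_frac \<alpha> 1 - hull_frac \<beta> 1"
        using hull_frac_add [of "\<alpha> - \<beta>" \<beta>] by (simp add: algebra_simps)
      finally show ?thesis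
        using that by (simp add: weight hull_value_def \<alpha> algebra_simps)
    qed
    then show ?thesis
      using le [OF that] by (simp add: order_less_le)
  qed
  have inf: "hull.weight \<delta> (poly_x_plus_y f) b = Infty" if "\<nu> (hasse_deriv b f) = Infty" for b
    using that by (simp add: weight hull_value_def)
  have f: "hull_value \<nu> f \<noteq> Infty"
    using fin by simp
  have all: "(\<forall>x\<in>?S. P x) \<longleftrightarrow> (\<forall>b\<ge>1. \<forall>\<beta>. \<nu> (hasse_deriv b f) = Fin \<beta> \<longrightarrow> P (hull_frac (\<alpha> - \<beta>) b))"
    for P
    by blast
  have ext: "(\<forall>\<beta>. x = Fin \<beta> \<longrightarrow> C) \<longleftrightarrow> x \<noteq> Infty \<longrightarrow> C" for x :: "'v extval" and C
    by (cases x) auto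
  have "epsilon \<nu> f \<le> Fin \<delta> \<longleftrightarrow> (\<forall>x\<in>?S. x \<le> \<delta>)"
    unfolding eps using finS neS by simp
  also have "\<dots> \<longleftrightarrow> (\<forall>b\<ge>1. hull_value \<nu> f \<le> hull.weight \<delta> (poly_x_plus_y f) b)"
    unfolding all using le inf by (metis extval.exhaust extval_le_Infty)
  also have "\<dots> \<longleftrightarrow> eps_le \<delta> f"
    unfolding eps_le_def by (metis less_one not_le order_refl weight_taylor_0)
  finally show "epsilon \<nu> f \<le> Fin \<delta> \<longleftrightarrow> eps_le \<delta> f" .
  have "epsilon \<nu> f < Fin \<delta> \<longleftrightarrow> (\<forall>x\<in>?S. x < \<delta>)"
    unfolding eps using finS neS by simp
  also have "\<dots> \<longleftrightarrow> eps_less \<delta> f"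
    unfolding all eps_less_def using less inf f by (metis extval.exhaust Fin_less_simps(2))
  finally show "epsilon \<nu> f < Fin \<delta> \<longleftrightarrow> eps_less \<delta> f" .
qed

lemma eps_less_const: "a \<noteq> 0 \<Longrightarrow> eps_less \<delta> [:a:]"
  using val_const_finite [of a]
  by (cases "hull_value \<nu> [:a:]") (auto simp: eps_less_def hull.weight_def coeff_pCons split: nat.split)

lemma eps_le_0: "eps_le \<delta> 0"
  by (simp add: eps_le_def hull.weight_def)

lemma eps_less_degree_0: "degree f = 0 \<Longrightarrow> f \<noteq> 0 \<Longrightarrow> eps_less \<delta> f"
  using eps_less_const by (metis degree_eq_zeroE pCons_0_0)

lemma eps_le_mult:
  assumes "eps_le \<delta> f" "eps_le \<delta> g" "\<nu> f \<noteq> Infty" "\<nu> g \<noteq> Infty"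
  shows "eps_le \<delta> (f * g)"
proof -
  obtain m n where "hull_value \<nu> f = Fin m" "hull_value \<nu> g = Fin n"
    using assms(3,4) by (cases "hull_value \<nu> f"; cases "hull_value \<nu> g") auto
  then show ?thesis
    using assms(1,2) hull.weight_mult_ge [of m \<delta> "poly_x_plus_y f" n "poly_x_plus_y g"]
    by (simp add: eps_le_def poly_x_plus_y_mult hull.val_mult)
qed

lemma eps_less_mult:
  assumes "eps_less \<delta> f" "eps_less \<delta> g" "\<nu> f \<noteq> Infty" "\<nu> g \<noteq> Infty"
  shows "eps_less \<delta> (f * g)"
proof -
  obtain m n where mn: "hull_value \<nu> f = Fin m" "hull_value \<nu> g = Fin n"
    using assms(3,4) by (cases "hull_value \<nu> f"; cases "hull_value \<nu> g") auto
  then have "hull_value \<nu> (f * g) = Fin (m + n)"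
    by (simp add: hull.val_mult)
  then show ?thesis
    using assms(1,2) mn hull.leading_mult [of \<delta> "poly_x_plus_y f" m 0 "poly_x_plus_y g" n 0]
    by (simp add: eps_less_iff_leading poly_x_plus_y_mult)
qed

lemma eps_le_add:
  assumes "eps_le \<delta> f" "eps_le \<delta> g" "\<nu> (f + g) \<le> \<nu> f" "\<nu> (f + g) \<le> \<nu> g"
  shows "eps_le \<delta> (f + g)"
  unfolding eps_le_def poly_x_plus_y_add
proof
  fix b
  have "hull_value \<nu> (f + g) \<le> hull.weight \<delta> (poly_x_plus_y f) b"
    using assms(1,3) unfolding eps_le_def by (meson hull_value_le_iff order_trans)
  moreover have "hull_value \<nu> (f + g) \<le> hull.weight \<delta> (poly_x_plus_y g) b"
    using assms(2,4) unfolding eps_le_def by (meson hull_value_le_iff order_trans)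
  ultimately show "hull_value \<nu> (f + g) \<le> hull.weight \<delta> (poly_x_plus_y f + poly_x_plus_y g) b"
    by (rule hull.weight_add_ge)
qed

lemma epsilon_smult:
  assumes "0 < degree f" "\<nu> f \<noteq> Infty" "c \<noteq> 0"
  shows "epsilon \<nu> (smult c f) = epsilon \<nu> f"
proof -
  have le: "epsilon \<nu> (smult a g) \<le> epsilon \<nu> g" if g: "0 < degree g" "\<nu> g \<noteq> Infty" and a: "a \<noteq> 0" for a g
  proof -
    obtain \<delta> where \<delta>: "epsilon \<nu> g = Fin \<delta>"
      using epsilon_finite g by blast
    have "\<nu> (smult a g) \<noteq> Infty"
      using val_mult [of "[:a:]" g] g a val_const_finite by simp
    moreover have "eps_le \<delta> (smult a g)"
      using eps_le_mult [of \<delta> "[:a:]" g] eps_less_imp_le [OF eps_less_const, of a \<delta>] a g \<delta>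
        epsilon_le_iff [OF g, of \<delta>] val_const_finite by simp
    ultimately show ?thesis
      using g a \<delta> epsilon_le_iff [of "smult a g" \<delta>] by simp
  qed
  have "\<nu> (smult c f) \<noteq> Infty"
    using val_mult [of "[:c:]" f] assms val_const_finite by simp
  then have "epsilon \<nu> (smult (inverse c) (smult c f)) \<le> epsilon \<nu> (smult c f)"
    using assms by (intro le) auto
  then show ?thesis
    using le [OF assms] assms(3) by simp
qed

text \<open>
  The hypotheses on \<open>Q\<close> say \<open>\<epsilon>(Q) = \<delta>\<close>. So the initial form of \<open>Q(x + y)\<close> has positive degree in \<open>y\<close>,
  hence so has that of \<open>(Q h)(x + y)\<close>, while the initial form of \<open>r(x + y)\<close> has degree \<open>0\<close>: the top term
  of the former cannot be cancelled. If it belongs to the initial form of \<open>f(x + y)\<close>, where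
  \<open>f = r + Q h\<close>, then the latter has positive degree in \<open>y\<close>, and \<open>\<epsilon>(f) < \<delta>\<close> fails.
\<close>

lemma
  assumes Q: "\<nu> Q \<noteq> Infty" "eps_le \<delta> Q" "\<not> eps_less \<delta> Q"
    and h: "\<nu> h \<noteq> Infty"
    and r: "r = 0 \<or> eps_less \<delta> r"
  shows no_cancellation_remainder: "eps_le \<delta> (r + Q * h) \<Longrightarrow> \<nu> (r + Q * h) \<le> \<nu> r"
    and dominant_remainder: "eps_less \<delta> (r + Q * h) \<Longrightarrow> \<nu> r < \<nu> (Q * h)"
proof -
  define f where "f = r + Q * h"
  obtain m d where Qlead: "hull.leading \<delta> (poly_x_plus_y Q) m d"
    by (rule hull.leading_exists [of "poly_x_plus_y Q" \<delta>])
      (use Q(1) hasse_deriv_0 [of Q] in \<open>simp add: hasse_deriv_def\<close>)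
  have "hull_value \<nu> Q = Fin m"
  proof (rule antisym)
    show "hull_value \<nu> Q \<le> Fin m"
      using Q(2) Qlead by (metis eps_le_def hull.leading_def)
    show "Fin m \<le> hull_value \<nu> Q"
      using Qlead by (metis hull.leading_def weight_taylor_0)
  qed
  then have d: "0 < d"
    using Qlead Q(3) eps_less_iff_leading by (cases d) auto
  obtain m' d' where hlead: "hull.leading \<delta> (poly_x_plus_y h) m' d'"
    by (rule hull.leading_exists [of "poly_x_plus_y h" \<delta>])
      (use h hasse_deriv_0 [of h] in \<open>simp add: hasse_deriv_def\<close>)
  define M D where "M = m + m'" and "D = d + d'"
  have lead: "hull.leading \<delta> (poly_x_plus_y (Q * h)) M D"
    unfolding poly_x_plus_y_mult M_def D_def using Qlead hlead by (rule hull.leading_mult)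
  have D: "0 < D"
    using d by (simp add: D_def)
  have M: "Fin M \<le> hull_value \<nu> (Q * h)"
    using lead by (metis hull.leading_def weight_taylor_0)
  \<comment> \<open>If \<open>M \<le> \<nu>(r)\<close>, the terms of \<open>r(x + y)\<close> of degree \<open>D \<ge> 1\<close> or more have values above \<open>M\<close>.\<close>
  have cancel_free: "hull.leading \<delta> (poly_x_plus_y f) M D" if "Fin M \<le> hull_value \<nu> r"
  proof -
    have "Fin M \<le> hull.weight \<delta> (poly_x_plus_y r) b" for b
      using r that eps_less_imp_le [of \<delta> r] eps_le_0 [of \<delta>] unfolding eps_le_def
      by (metis order_trans)
    moreover have "Fin M < hull.weight \<delta> (poly_x_plus_y r) b" if "D \<le> b" for b
    proof (cases "r = 0")
      case True
      then show ?thesis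
        by (simp add: hull.weight_def)
    next
      case False
      then have "hull_value \<nu> r < hull.weight \<delta> (poly_x_plus_y r) b"
        using r D that by (auto simp: eps_less_def)
      then show ?thesis
        using \<open>Fin M \<le> hull_value \<nu> r\<close> by (rule order_le_less_trans [rotated])
    qed
    ultimately have "hull.leading \<delta> (poly_x_plus_y (Q * h) + poly_x_plus_y r) M D"
      using lead by (intro hull.leading_add_dominant)
    then show ?thesis
      by (simp add: f_def poly_x_plus_y_add add.commute)
  qed
  have small: "\<nu> r < \<nu> (Q * h)" if "hull_value \<nu> r < Fin M"
    using that M by (metis hull_value_less_iff order_less_le_trans)
  show "\<nu> (r + Q * h) \<le> \<nu> r" if "eps_le \<delta> (r + Q * h)"
  proof (cases "hull_value \<nu> r < Fin M")
    case True
    then show ?thesis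
      using small val_add_eq by simp
  next
    case False
    then have "hull_value \<nu> f \<le> Fin M"
      using that cancel_free by (metis eps_le_def f_def hull.leading_def not_less)
    then have "hull_value \<nu> f \<le> hull_value \<nu> r"
      using False by (meson not_less order_trans)
    then show ?thesis
      by (simp add: f_def)
  qed
  show "\<nu> r < \<nu> (Q * h)" if "eps_less \<delta> (r + Q * h)"
  proof (rule small, rule ccontr)
    assume "\<not> hull_value \<nu> r < Fin M"
    then have f: "hull.leading \<delta> (poly_x_plus_y f) M D"
      using cancel_free by simp
    then have "hull_value \<nu> f < Fin M"
      using that D unfolding eps_less_def f_def hull.leading_def by (metis One_nat_def Suc_le_eq)
    moreover have "Fin M \<le> hull_value \<nu> f"
      using f by (metis hull.leading_def weight_taylor_0)
    ultimately show False
      by simp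
  qed
qed


section \<open>Minimal polynomials and key polynomials\<close>

lemma degree_mod_less_pos: "0 < degree Q \<Longrightarrow> degree (f mod Q) < degree Q" for f Q :: "'a poly"
  by (cases "f mod Q = 0") (auto intro: degree_mod_less')

text \<open>
  Initial forms do not occur here: the last condition says that no nonzero polynomial of degree below
  \<open>deg \<phi>\<close> has an initial form divisible by that of \<open>\<phi>\<close>. Indeed, if \<open>r = f mod \<phi>\<close> has smaller value
  than \<open>f\<close>, then \<open>r\<close> and the multiple \<open>r - f\<close> of \<open>\<phi>\<close> have the same initial form.
\<close>

definition val_minimal :: "'a poly \<Rightarrow> bool" where
  "val_minimal \<phi> \<longleftrightarrow>
    lead_coeff \<phi> = 1 \<and> 0 < degree \<phi> \<and> \<nu> \<phi> \<noteq> Infty \<and>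
    (\<forall>f. f \<noteq> 0 \<longrightarrow> \<nu> f \<noteq> Infty) \<and> (\<forall>f. \<nu> f \<le> \<nu> (f mod \<phi>))"

lemma val_minimal_div:
  assumes "val_minimal \<phi>"
  shows "\<nu> f \<le> \<nu> (\<phi> * (f div \<phi>))"
proof -
  have "\<nu> f \<le> \<nu> (f - f mod \<phi>)"
    using assms by (intro val_diff_ge) (auto simp: val_minimal_def)
  then show ?thesis
    by (simp add: minus_mod_eq_mult_div)
qed

lemma val_minimal_value:
  assumes "val_minimal \<phi>"
  shows "\<nu> f = min (\<nu> (f mod \<phi>)) (\<nu> (\<phi> * (f div \<phi>)))"
proof (rule antisym)
  show "\<nu> f \<le> min (\<nu> (f mod \<phi>)) (\<nu> (\<phi> * (f div \<phi>)))"
    using assms val_minimal_div by (simp add: val_minimal_def)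
  show "min (\<nu> (f mod \<phi>)) (\<nu> (\<phi> * (f div \<phi>))) \<le> \<nu> f"
    using val_add [of "f mod \<phi>" "\<phi> * (f div \<phi>)"] by simp
qed

text \<open>Horner's scheme: the values of \<open>a + \<phi> g\<close> are controlled by one division with remainder.\<close>

lemma val_minimal_poly_value:
  assumes \<phi>: "val_minimal \<phi>" and A: "\<And>s. degree (coeff A s) < degree \<phi>"
  shows "\<nu> (poly A \<phi>) = Min ((\<lambda>s. \<nu> (coeff A s * \<phi> ^ s)) ` {..degree A})"
  using A
proof (induction A)
  case 0
  then show ?case
    by simp
next
  case (pCons a B)
  have a: "degree a < degree \<phi>"
    using pCons.prems [of 0] by simp
  have B: "degree (coeff B s) < degree \<phi>" for s
    using pCons.prems [of "Suc s"] by simp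
  have \<phi>0: "\<phi> \<noteq> 0"
    using \<phi> by (auto simp: val_minimal_def)
  have "poly (pCons a B) \<phi> mod \<phi> = a" "poly (pCons a B) \<phi> div \<phi> = poly B \<phi>"
    using a \<phi>0 by (simp_all add: mod_poly_less div_poly_less)
  then have split: "\<nu> (poly (pCons a B) \<phi>) = min (\<nu> a) (\<nu> (\<phi> * poly B \<phi>))"
    using val_minimal_value [OF \<phi>, of "poly (pCons a B) \<phi>"] by simp
  show ?case
  proof (cases "B = 0")
    case True
    then show ?thesis
      using split by simp
  next
    case False
    let ?F = "\<lambda>s. \<nu> (coeff B s * \<phi> ^ s)"
    have "\<nu> (\<phi> * poly B \<phi>) = \<nu> \<phi> + Min (?F ` {..degree B})"
      using pCons.IH [OF B] by (simp add: val_mult)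
    also have "\<dots> = Min ((\<lambda>x. \<nu> \<phi> + x) ` ?F ` {..degree B})"
      by (rule mono_Min_commute) (auto simp: mono_def intro: add_left_mono)
    also have "(\<lambda>x. \<nu> \<phi> + x) ` ?F ` {..degree B}
        = (\<lambda>s. \<nu> (coeff (pCons a B) s * \<phi> ^ s)) ` Suc ` {..degree B}"
      by (simp add: image_image val_mult ac_simps)
    finally have "\<nu> (poly (pCons a B) \<phi>)
        = min (\<nu> a) (Min ((\<lambda>s. \<nu> (coeff (pCons a B) s * \<phi> ^ s)) ` Suc ` {..degree B}))"
      using split by simp
    also have "\<dots> = Min (insert (\<nu> a) ((\<lambda>s. \<nu> (coeff (pCons a B) s * \<phi> ^ s)) ` Suc ` {..degree B}))"
      by (subst Min_insert) auto
    also have "insert (\<nu> a) ((\<lambda>s. \<nu> (coeff (pCons a B) s * \<phi> ^ s)) ` Suc ` {..degree B})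
        = (\<lambda>s. \<nu> (coeff (pCons a B) s * \<phi> ^ s)) ` insert 0 (Suc ` {..degree B})"
      by simp
    also have "insert 0 (Suc ` {..degree B}) = {..degree (pCons a B)}"
      using False by (simp add: atMost_Suc_eq_insert_0)
    finally show ?thesis .
  qed
qed

lemma truncation_val_minimal:
  assumes "val_minimal \<phi>"
  shows "truncation \<nu> \<phi> = \<nu>"
proof
  fix f
  have "is_expansion \<phi> f (expansion \<phi> f)"
    using assms by (intro is_expansion_expansion) (simp add: val_minimal_def)
  then show "truncation \<nu> \<phi> f = \<nu> f"
    using val_minimal_poly_value [OF assms, of "expansion \<phi> f"]
    by (simp add: truncation_def is_expansion_def)
qed

text \<open>
  Let \<open>Q\<close> be a counterexample of least degree. Then \<open>\<epsilon>(Q)\<close> exceeds both \<open>\<epsilon>(\<phi>)\<close> and the \<open>\<epsilon>\<close> of every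
  polynomial of positive degree below \<open>deg Q\<close>. By \<open>dominant_remainder\<close>, \<open>\<phi>\<close> has the same initial form as its remainder modulo
  \<open>Q\<close>. That remainder has smaller degree than \<open>\<phi>\<close>, which \<open>val_minimal\<close> excludes.
\<close>

lemma epsilon_le_val_minimal_small_degree:
  assumes \<phi>: "val_minimal \<phi>" and f: "0 < degree f" "degree f < degree \<phi>"
  shows "epsilon \<nu> f \<le> epsilon \<nu> \<phi>"
proof (rule ccontr)
  assume "\<not> epsilon \<nu> f \<le> epsilon \<nu> \<phi>"
  define bad where "bad = (\<lambda>Q. 0 < degree Q \<and> degree Q < degree \<phi> \<and> epsilon \<nu> \<phi> < epsilon \<nu> Q)"
  have "bad f"
    using f \<open>\<not> _\<close> by (simp add: bad_def)
  then obtain Q where Q: "bad Q" and least: "\<And>c. bad c \<Longrightarrow> degree Q \<le> degree c"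
    using ex_has_least_nat [of bad f degree] by blast
  have fin: "g \<noteq> 0 \<Longrightarrow> \<nu> g \<noteq> Infty" for g
    using \<phi> by (simp add: val_minimal_def)
  have Q0: "0 < degree Q" "degree Q < degree \<phi>" and \<phi>Q: "epsilon \<nu> \<phi> < epsilon \<nu> Q"
    using Q by (auto simp: bad_def)
  have Qfin: "\<nu> Q \<noteq> Infty"
    using Q0 by (intro fin) auto
  then obtain \<delta> where \<delta>: "epsilon \<nu> Q = Fin \<delta>"
    using epsilon_finite Q0 by blast
  define r h where "r = \<phi> mod Q" and "h = \<phi> div Q"
  have \<phi>eq: "\<phi> = r + Q * h"
    by (simp add: r_def h_def)
  have rdeg: "degree r < degree Q"
    unfolding r_def using Q0(1) by (rule degree_mod_less_pos)
  have "r = 0 \<or> eps_less \<delta> r"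
  proof (cases "degree r = 0")
    case True
    then show ?thesis
      using eps_less_degree_0 by blast
  next
    case False
    then have "\<not> bad r"
      using least [of r] rdeg by auto
    then have "epsilon \<nu> r < Fin \<delta>"
      using False rdeg Q0 \<phi>Q \<delta> by (auto simp: bad_def)
    then show ?thesis
      using epsilon_less_iff [of r] fin [of r] False by auto
  qed
  moreover have "h \<noteq> 0"
    using \<phi>eq rdeg Q0 by auto
  moreover have "eps_less \<delta> \<phi>"
    using epsilon_less_iff [of \<phi> \<delta>] \<phi>Q \<phi> unfolding \<delta> val_minimal_def by simp
  ultimately have "\<nu> r < \<nu> (Q * h)"
    using Qfin epsilon_le_iff [of Q \<delta>] epsilon_less_iff [of Q \<delta>] Q0 \<delta> fin \<phi>eq
    by (intro dominant_remainder [of Q \<delta>]) auto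
  \<comment> \<open>Division of \<open>- Q h = r - \<phi>\<close> by \<open>\<phi>\<close> leaves \<open>r\<close>, whose value would be too small.\<close>
  moreover have "(- (Q * h)) mod \<phi> = r"
  proof -
    have "- (Q * h) = r - \<phi>"
      using \<phi>eq by (simp add: algebra_simps)
    then show ?thesis
      using rdeg Q0 by (simp add: mod_poly_less poly_mod_diff_left)
  qed
  then have "\<nu> (Q * h) \<le> \<nu> r"
    using \<phi> val_uminus [of "Q * h"] unfolding val_minimal_def by metis
  ultimately show False
    by simp
qed

text \<open>
  The bound passes from the quotient and the remainder modulo \<open>\<phi>\<close> to \<open>f\<close>, since both summands of
  \<open>f = f mod \<phi> + \<phi> (f div \<phi>)\<close> have at least the value of \<open>f\<close>.
\<close>

lemma eps_le_val_minimal: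
  assumes \<phi>: "val_minimal \<phi>" and \<delta>: "epsilon \<nu> \<phi> = Fin \<delta>"
  shows "eps_le \<delta> f"
proof (induction "degree f" arbitrary: f rule: less_induct)
  case less
  have fin: "g \<noteq> 0 \<Longrightarrow> \<nu> g \<noteq> Infty" for g
    using \<phi> by (simp add: val_minimal_def)
  have \<phi>0: "0 < degree \<phi>" "\<phi> \<noteq> 0" "eps_le \<delta> \<phi>"
    using \<phi> \<delta> epsilon_le_iff [of \<phi> \<delta>] by (auto simp: val_minimal_def)
  consider "f = 0" | "f \<noteq> 0" "degree f = 0" | "0 < degree f" "degree f < degree \<phi>"
    | "degree \<phi> \<le> degree f"
    by linarith
  then show ?case
  proof cases
    case 1
    then show ?thesis
      by (simp add: eps_le_0)
  next
    case 2
    then show ?thesis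
      by (simp add: eps_less_degree_0 eps_less_imp_le)
  next
    case 3
    then have "\<nu> f \<noteq> Infty"
      by (intro fin) auto
    then show ?thesis
      using 3 epsilon_le_val_minimal_small_degree [OF \<phi>, of f] epsilon_le_iff [of f \<delta>] \<delta> by simp
  next
    case 4
    then have "degree (f mod \<phi>) < degree f"
      using degree_mod_less_pos [OF \<phi>0(1), of f] by simp
    then have r: "eps_le \<delta> (f mod \<phi>)"
      by (rule less)
    have "degree (f div \<phi>) < degree f"
      using 4 \<phi>0 by (simp add: degree_div_less)
    then have h: "eps_le \<delta> (f div \<phi>)"
      by (rule less)
    have "eps_le \<delta> (\<phi> * (f div \<phi>))"
      using \<phi>0 h fin by (cases "f div \<phi> = 0") (auto simp: eps_le_0 intro: eps_le_mult)
    then have "eps_le \<delta> (f mod \<phi> + \<phi> * (f div \<phi>))"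
      using r \<phi> val_minimal_div [OF \<phi>] by (intro eps_le_add) (auto simp: val_minimal_def)
    then show ?thesis
      by simp
  qed
qed

lemma epsilon_le_val_minimal:
  assumes \<phi>: "val_minimal \<phi>" and f: "0 < degree f"
  shows "epsilon \<nu> f \<le> epsilon \<nu> \<phi>"
proof -
  obtain \<delta> where \<delta>: "epsilon \<nu> \<phi> = Fin \<delta>"
    using \<phi> epsilon_finite unfolding val_minimal_def by blast
  have "\<nu> f \<noteq> Infty"
    using \<phi> f unfolding val_minimal_def by (metis degree_0 less_irrefl)
  then show ?thesis
    using eps_le_val_minimal [OF \<phi> \<delta>] epsilon_le_iff [OF f] \<delta> by simp
qed

text \<open>
  If \<open>\<delta> = \<epsilon>(Q)\<close> is the largest value of \<open>\<epsilon>\<close>, then \<open>no_cancellation_remainder\<close> applies to every \<open>f\<close>.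
  The product \<open>f g\<close> of nonzero polynomials of degree below \<open>deg Q\<close> even satisfies \<open>\<epsilon>(f g) < \<delta>\<close>, so that
  \<open>dominant_remainder\<close> applies to it.
\<close>

lemma key_polynomial_of_maximal_level:
  assumes fin: "\<And>f. f \<noteq> 0 \<Longrightarrow> \<nu> f \<noteq> Infty"
    and Q: "key_polynomial \<nu> Q" and \<delta>: "epsilon \<nu> Q = Fin \<delta>"
    and max: "\<And>f. eps_le \<delta> f"
  shows "val_minimal Q"
    and "degree f < degree Q \<Longrightarrow> degree g < degree Q \<Longrightarrow> \<nu> ((f * g) mod Q) = \<nu> (f * g)"
proof -
  have Q0: "lead_coeff Q = 1" "0 < degree Q" "Q \<noteq> 0"
    using Q by (auto simp: key_polynomial_def)
  then have Qle: "\<nu> Q \<noteq> Infty" "eps_le \<delta> Q" "\<not> eps_less \<delta> Q"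
    using fin epsilon_less_iff [of Q \<delta>] max \<delta> by auto
  have small: "c = 0 \<or> eps_less \<delta> c" if "degree c < degree Q" for c
  proof (cases "degree c = 0")
    case True
    then show ?thesis
      using eps_less_degree_0 by blast
  next
    case False
    then have "epsilon \<nu> c < Fin \<delta>"
      using Q that unfolding key_polynomial_def \<delta> by simp
    moreover have "\<nu> c \<noteq> Infty"
      using False by (intro fin) auto
    ultimately show ?thesis
      using False epsilon_less_iff [of c] by simp
  qed
  have rem: "f mod Q = 0 \<or> eps_less \<delta> (f mod Q)" for f
    by (rule small [OF degree_mod_less_pos [OF Q0(2)]])
  have "\<nu> f \<le> \<nu> (f mod Q)" for f
  proof (cases "f div Q = 0")
    case True
    then have "f mod Q = f"
      using div_mult_mod_eq [of f Q] by simp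
    then show ?thesis
      by simp
  next
    case False
    then show ?thesis
      using no_cancellation_remainder [OF Qle, of "f div Q" "f mod Q"] fin rem max by simp
  qed
  then show "val_minimal Q"
    using Q0 Qle fin by (simp add: val_minimal_def)
  assume fg: "degree f < degree Q" "degree g < degree Q"
  show "\<nu> ((f * g) mod Q) = \<nu> (f * g)"
  proof (cases "f = 0 \<or> g = 0 \<or> (f * g) div Q = 0")
    case True
    then have "(f * g) mod Q = f * g"
      by (metis add.left_neutral div_mult_mod_eq mod_0 mult_zero_left mult_zero_right)
    then show ?thesis
      by simp
  next
    case False
    then have "eps_less \<delta> (f * g)"
      using small fg fin by (intro eps_less_mult) auto
    then have "\<nu> ((f * g) mod Q) < \<nu> (Q * ((f * g) div Q))"
      using False fin rem by (intro dominant_remainder [OF Qle]) auto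
    then have "\<nu> ((f * g) mod Q + Q * ((f * g) div Q)) = \<nu> ((f * g) mod Q)"
      by (rule val_add_eq)
    then show ?thesis
      by simp
  qed
qed

text \<open>
  The polynomial \<open>Q\<close> is chosen of least degree among the non-constant monic ones with
  \<open>\<epsilon>(Q) \<ge> \<epsilon>(\<phi>)\<close>. Since multiplication by constants preserves \<open>\<epsilon>\<close>, polynomials of smaller positive
  degree have \<open>\<epsilon> < \<epsilon>(\<phi>)\<close>, monic or not. Equality holds because \<open>\<epsilon>(\<phi>)\<close> is maximal.
\<close>

lemma smaller_key_polynomial_exists:
  assumes \<phi>: "val_minimal \<phi>" and nokey: "\<not> key_polynomial \<nu> \<phi>"
  obtains Q where "key_polynomial \<nu> Q" "degree Q < degree \<phi>" "epsilon \<nu> Q = epsilon \<nu> \<phi>"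
proof -
  have fin: "g \<noteq> 0 \<Longrightarrow> \<nu> g \<noteq> Infty" for g
    using \<phi> by (simp add: val_minimal_def)
  define good where "good = (\<lambda>Q. lead_coeff Q = 1 \<and> 0 < degree Q \<and> epsilon \<nu> \<phi> \<le> epsilon \<nu> Q)"
  have monic: "\<exists>Q. good Q \<and> degree Q = degree f" if "0 < degree f" "epsilon \<nu> \<phi> \<le> epsilon \<nu> f" for f
  proof (intro exI conjI)
    have f: "f \<noteq> 0"
      using that by auto
    then show "good (smult (inverse (lead_coeff f)) f)"
      using that epsilon_smult [of f "inverse (lead_coeff f)"] fin [of f] by (simp add: good_def)
    show "degree (smult (inverse (lead_coeff f)) f) = degree f"
      using f by simp
  qed
  obtain f where f: "0 < degree f" "degree f < degree \<phi>" "epsilon \<nu> \<phi> \<le> epsilon \<nu> f"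
    using nokey \<phi> by (auto simp: key_polynomial_def val_minimal_def not_less)
  then obtain Q1 where Q1: "good Q1" "degree Q1 < degree \<phi>"
    using monic [of f] by auto
  then obtain Q where Q: "good Q" and least: "\<And>c. good c \<Longrightarrow> degree Q \<le> degree c"
    using ex_has_least_nat [of good Q1 degree] by blast
  have "epsilon \<nu> c < epsilon \<nu> Q" if "0 < degree c" "degree c < degree Q" for c
  proof -
    have "\<not> epsilon \<nu> \<phi> \<le> epsilon \<nu> c"
      using monic [of c] least that by (metis leD)
    then show ?thesis
      using Q by (auto simp: good_def)
  qed
  then have "key_polynomial \<nu> Q"
    using Q by (auto simp: good_def key_polynomial_def)
  moreover have "degree Q < degree \<phi>"
    using least [OF Q1(1)] Q1(2) by simp
  moreover have "epsilon \<nu> Q = epsilon \<nu> \<phi>"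
    using Q epsilon_le_val_minimal [OF \<phi>, of Q] by (auto simp: good_def)
  ultimately show ?thesis
    by (rule that)
qed

end


section \<open>Representing elements of the graded algebra\<close>

lemma val_ge_group_simps [simp]:
  "carrier (val_ge_group \<nu> \<alpha>) = val_ge \<nu> \<alpha>"
  "mult (val_ge_group \<nu> \<alpha>) = (+)"
  "one (val_ge_group \<nu> \<alpha>) = 0"
  by (simp_all add: val_ge_group_def)

context valued_polynomials
begin

lemma value_group_value: "\<nu> f = Fin \<alpha> \<Longrightarrow> \<alpha> \<in> value_group \<nu>"
  unfolding value_group_def by (rule generate.incl) auto

lemma value_group_add: "\<alpha> \<in> value_group \<nu> \<Longrightarrow> \<beta> \<in> value_group \<nu> \<Longrightarrow> \<alpha> + \<beta> \<in> value_group \<nu>"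
  unfolding value_group_def using generate.eng by fastforce

lemma value_group_diff:
  assumes "\<alpha> \<in> value_group \<nu>" "\<beta> \<in> value_group \<nu>"
  shows "\<alpha> - \<beta> \<in> value_group \<nu>"
proof -
  let ?M = "\<lparr>carrier = UNIV, mult = (+), one = 0\<rparr> :: 'v monoid"
  interpret M: group ?M
  proof (rule groupI)
    show "\<exists>y\<in>carrier ?M. y \<otimes>\<^bsub>?M\<^esub> x = \<one>\<^bsub>?M\<^esub>" for x
      by (rule bexI [of _ "- x"]) auto
  qed (auto simp: add.assoc)
  have "inv\<^bsub>?M\<^esub> \<beta> = - \<beta>"
    by (rule M.inv_equality) auto
  then have "- \<beta> \<in> value_group \<nu>"
    using M.generate_m_inv_closed [OF _ assms(2) [unfolded value_group_def]]
    by (simp add: value_group_def)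
  then show ?thesis
    using value_group_add [OF assms(1)] by fastforce
qed

lemma comm_group_val_ge: "comm_group (val_ge_group \<nu> \<alpha>)"
proof (rule comm_groupI)
  fix x y z
  assume "x \<in> carrier (val_ge_group \<nu> \<alpha>)"
  then show "\<exists>y\<in>carrier (val_ge_group \<nu> \<alpha>). y \<otimes>\<^bsub>val_ge_group \<nu> \<alpha>\<^esub> x = \<one>\<^bsub>val_ge_group \<nu> \<alpha>\<^esub>"
    by (intro bexI [of _ "- x"]) (auto simp: val_ge_def)
qed (auto simp: val_ge_def ac_simps intro: val_add_ge)

lemma val_gt_subgroup: "subgroup (val_gt \<nu> \<alpha>) (val_ge_group \<nu> \<alpha>)"
proof -
  interpret comm_group "val_ge_group \<nu> \<alpha>"
    by (rule comm_group_val_ge)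
  have inv: "inv\<^bsub>val_ge_group \<nu> \<alpha>\<^esub> x = - x" if "Fin \<alpha> \<le> \<nu> x" for x
    using that by (intro inv_equality) (auto simp: val_ge_def)
  show ?thesis
    by (rule subgroupI)
      (auto simp: val_gt_def val_ge_def inv less_imp_le intro: val_add_gt exI [of _ 0])
qed

lemma in_class_iff: "k \<in> in_class \<nu> \<alpha> g \<longleftrightarrow> Fin \<alpha> < \<nu> (k - g)"
proof
  assume "k \<in> in_class \<nu> \<alpha> g"
  then show "Fin \<alpha> < \<nu> (k - g)"
    by (auto simp: in_class_def r_coset_def val_gt_def)
next
  assume "Fin \<alpha> < \<nu> (k - g)"
  then show "k \<in> in_class \<nu> \<alpha> g"
    by (auto simp: in_class_def r_coset_def val_gt_def intro!: bexI [of _ "k - g"])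
qed

lemma in_class_eq_iff: "in_class \<nu> \<alpha> f = in_class \<nu> \<alpha> g \<longleftrightarrow> Fin \<alpha> < \<nu> (f - g)"
proof
  assume "in_class \<nu> \<alpha> f = in_class \<nu> \<alpha> g"
  moreover have "f \<in> in_class \<nu> \<alpha> f"
    by (simp add: in_class_iff)
  ultimately show "Fin \<alpha> < \<nu> (f - g)"
    by (simp add: in_class_iff)
next
  assume fg: "Fin \<alpha> < \<nu> (f - g)"
  have "Fin \<alpha> < \<nu> (k - f) \<longleftrightarrow> Fin \<alpha> < \<nu> (k - g)" for k
    using val_add_gt [of "Fin \<alpha>" "k - f" "f - g"] val_diff_gt [of "Fin \<alpha>" "k - g" "f - g"] fg
    by auto
  then show "in_class \<nu> \<alpha> f = in_class \<nu> \<alpha> g"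
    by (auto simp: in_class_iff)
qed

lemma in_class_0: "in_class \<nu> \<alpha> 0 = val_gt \<nu> \<alpha>"
  by (auto simp: in_class_iff val_gt_def)

lemma comm_group_graded_piece: "comm_group (graded_piece \<nu> \<alpha>)"
  unfolding graded_piece_def
  by (rule comm_group.abelian_FactGroup [OF comm_group_val_ge val_gt_subgroup])

lemma carrier_graded_piece: "carrier (graded_piece \<nu> \<alpha>) = in_class \<nu> \<alpha> ` val_ge \<nu> \<alpha>"
  by (simp add: graded_piece_def carrier_FactGroup in_class_def)

lemma one_graded_piece: "\<one>\<^bsub>graded_piece \<nu> \<alpha>\<^esub> = in_class \<nu> \<alpha> 0"
  by (simp add: graded_piece_def in_class_0)

lemma in_class_add:
  assumes "Fin \<alpha> \<le> \<nu> f" "Fin \<alpha> \<le> \<nu> g"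
  shows "in_class \<nu> \<alpha> f \<otimes>\<^bsub>graded_piece \<nu> \<alpha>\<^esub> in_class \<nu> \<alpha> g = in_class \<nu> \<alpha> (f + g)"
proof -
  interpret comm_group "val_ge_group \<nu> \<alpha>"
    by (rule comm_group_val_ge)
  have "val_gt \<nu> \<alpha> \<lhd> val_ge_group \<nu> \<alpha>"
    by (rule subgroup_imp_normal [OF val_gt_subgroup])
  then show ?thesis
    using assms by (simp add: graded_piece_def in_class_def normal.rcos_sum val_ge_def)
qed

lemma in_class_sum:
  assumes "finite S" "\<And>i. i \<in> S \<Longrightarrow> Fin \<gamma> \<le> \<nu> (h i)"
  shows "finprod (graded_piece \<nu> \<gamma>) (\<lambda>i. in_class \<nu> \<gamma> (h i)) S = in_class \<nu> \<gamma> (sum h S)"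
  using assms
proof (induction S rule: finite_induct)
  case empty
  interpret comm_group "graded_piece \<nu> \<gamma>"
    by (rule comm_group_graded_piece)
  show ?case
    by (simp add: one_graded_piece)
next
  case (insert i S)
  interpret comm_group "graded_piece \<nu> \<gamma>"
    by (rule comm_group_graded_piece)
  have "finprod (graded_piece \<nu> \<gamma>) (\<lambda>i. in_class \<nu> \<gamma> (h i)) (insert i S)
      = in_class \<nu> \<gamma> (h i) \<otimes>\<^bsub>graded_piece \<nu> \<gamma>\<^esub> in_class \<nu> \<gamma> (sum h S)"
    using insert by (subst finprod_insert) (auto simp: carrier_graded_piece val_ge_def)
  also have "\<dots> = in_class \<nu> \<gamma> (h i + sum h S)"
    using insert.prems by (intro in_class_add val_sum_ge) auto
  finally show ?case
    using insert.hyps by simp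
qed

lemma piece_mult_in_class:
  assumes "Fin \<alpha> \<le> \<nu> f" "Fin \<beta> \<le> \<nu> g"
  shows "piece_mult \<nu> \<alpha> \<beta> (in_class \<nu> \<alpha> f) (in_class \<nu> \<beta> g) = in_class \<nu> (\<alpha> + \<beta>) (f * g)"
proof -
  have "in_class \<nu> (\<alpha> + \<beta>) (f' * g') = in_class \<nu> (\<alpha> + \<beta>) (f * g)"
    if "f' \<in> in_class \<nu> \<alpha> f" "g' \<in> in_class \<nu> \<beta> g" for f' g'
  proof -
    have d: "Fin \<alpha> < \<nu> (f' - f)" "Fin \<beta> < \<nu> (g' - g)"
      using that by (simp_all add: in_class_iff)
    have "Fin \<beta> \<le> \<nu> g'"
      using val_add_ge [of "Fin \<beta>" "g' - g" g] d assms by simp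
    then have "Fin (\<alpha> + \<beta>) < \<nu> ((f' - f) * g' + f * (g' - g))"
      using d assms
      by (intro val_add_gt) (auto simp: val_mult intro: extval_add_less_le_mono extval_add_le_less_mono)
    then show ?thesis
      by (simp add: in_class_eq_iff algebra_simps)
  qed
  moreover have "f \<in> in_class \<nu> \<alpha> f" "g \<in> in_class \<nu> \<beta> g"
    by (simp_all add: in_class_iff)
  ultimately show ?thesis
    unfolding piece_mult_def by blast
qed

text \<open>
  Computations in the graded algebra are done with families of representatives: \<open>f\<close> selects
  a polynomial from the component of each degree, and \<open>0\<close> from all but finitely many of them.
\<close>

definition admissible :: "('v \<Rightarrow> 'a poly) \<Rightarrow> bool" where
  "admissible f \<longleftrightarrow> finite {\<alpha>. f \<alpha> \<noteq> 0} \<and> {\<alpha>. f \<alpha> \<noteq> 0} \<subseteq> value_group \<nu> \<and> (\<forall>\<alpha>. Fin \<alpha> \<le> \<nu> (f \<alpha>))"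

definition rep :: "('v \<Rightarrow> 'a poly) \<Rightarrow> 'v \<Rightarrow> 'a poly set" where
  "rep f = (\<lambda>\<alpha>\<in>value_group \<nu>. in_class \<nu> \<alpha> (f \<alpha>))"

definition conv :: "('v \<Rightarrow> 'a poly) \<Rightarrow> ('v \<Rightarrow> 'a poly) \<Rightarrow> 'v \<Rightarrow> 'a poly" where
  "conv f g \<gamma> = (\<Sum>\<alpha> | f \<alpha> \<noteq> 0. f \<alpha> * g (\<gamma> - \<alpha>))"

definition single :: "'v \<Rightarrow> 'a poly \<Rightarrow> 'v \<Rightarrow> 'a poly" where
  "single \<alpha> f = (\<lambda>\<beta>. if \<beta> = \<alpha> then f else 0)"

lemma rep_eq_iff: "rep f = rep g \<longleftrightarrow> (\<forall>\<alpha>\<in>value_group \<nu>. Fin \<alpha> < \<nu> (f \<alpha> - g \<alpha>))"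
proof -
  have "rep f = rep g \<longleftrightarrow> (\<forall>\<alpha>\<in>value_group \<nu>. in_class \<nu> \<alpha> (f \<alpha>) = in_class \<nu> \<alpha> (g \<alpha>))"
    unfolding rep_def fun_eq_iff restrict_def by auto
  then show ?thesis
    by (simp add: in_class_eq_iff)
qed

lemma carrier_graded_algebra:
  "carrier (graded_algebra \<nu>) =
    {x \<in> \<Pi>\<^sub>E \<alpha>\<in>value_group \<nu>. carrier (graded_piece \<nu> \<alpha>).
      finite {\<alpha> \<in> value_group \<nu>. x \<alpha> \<noteq> \<one>\<^bsub>graded_piece \<nu> \<alpha>\<^esub>}}"
  using comm_group_graded_piece
  by (simp add: graded_algebra_def carrier_sum_group comm_group.axioms(2))

lemma rep_in_carrier:
  assumes "admissible f"
  shows "rep f \<in> carrier (graded_algebra \<nu>)"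
proof -
  have "{\<alpha> \<in> value_group \<nu>. rep f \<alpha> \<noteq> \<one>\<^bsub>graded_piece \<nu> \<alpha>\<^esub>} \<subseteq> {\<alpha>. f \<alpha> \<noteq> 0}"
    by (auto simp: rep_def one_graded_piece)
  then have "finite {\<alpha> \<in> value_group \<nu>. rep f \<alpha> \<noteq> \<one>\<^bsub>graded_piece \<nu> \<alpha>\<^esub>}"
    using assms finite_subset by (auto simp: admissible_def)
  moreover have "rep f \<in> (\<Pi>\<^sub>E \<alpha>\<in>value_group \<nu>. carrier (graded_piece \<nu> \<alpha>))"
    using assms by (auto simp: rep_def carrier_graded_piece val_ge_def admissible_def)
  ultimately show ?thesis
    by (simp add: carrier_graded_algebra)
qed

lemma carrier_rep:
  assumes "F \<in> carrier (graded_algebra \<nu>)"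
  obtains f where "admissible f" "F = rep f"
proof -
  let ?supp = "{\<alpha> \<in> value_group \<nu>. F \<alpha> \<noteq> \<one>\<^bsub>graded_piece \<nu> \<alpha>\<^esub>}"
  have F: "F \<in> (\<Pi>\<^sub>E \<alpha>\<in>value_group \<nu>. carrier (graded_piece \<nu> \<alpha>))" and fin: "finite ?supp"
    using assms by (auto simp: carrier_graded_algebra)
  then have "\<exists>g. Fin \<alpha> \<le> \<nu> g \<and> F \<alpha> = in_class \<nu> \<alpha> g" if "\<alpha> \<in> value_group \<nu>" for \<alpha>
    using that by (auto simp: carrier_graded_piece val_ge_def PiE_iff)
  then obtain g where g: "Fin \<alpha> \<le> \<nu> (g \<alpha>)" "F \<alpha> = in_class \<nu> \<alpha> (g \<alpha>)" if "\<alpha> \<in> value_group \<nu>" for \<alpha>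
    by metis
  define f where "f \<alpha> = (if \<alpha> \<in> ?supp then g \<alpha> else 0)" for \<alpha>
  have supp: "{\<alpha>. f \<alpha> \<noteq> 0} \<subseteq> ?supp"
    by (auto simp: f_def)
  then have "finite {\<alpha>. f \<alpha> \<noteq> 0}"
    using fin finite_subset by blast
  then have "admissible f"
    using supp g unfolding admissible_def by (auto simp: f_def)
  moreover have "F = rep f"
  proof
    fix \<alpha>
    show "F \<alpha> = rep f \<alpha>"
      using F g [of \<alpha>] by (auto simp: rep_def f_def one_graded_piece PiE_iff extensional_def)
  qed
  ultimately show ?thesis
    by (rule that)
qed

text \<open>
  The product in the graded algebra runs over the degrees in which both components are nonzero, \<open>conv\<close>
  over those in which the representative of the first factor is nonzero. The additional summands
  have a factor whose class is zero, so they lie in higher filtration.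
\<close>

lemma rep_mult:
  assumes f: "admissible f" and g: "admissible g"
  shows "rep f \<otimes>\<^bsub>graded_algebra \<nu>\<^esub> rep g = rep (conv f g)"
proof
  fix \<gamma>
  let ?S = "{\<alpha> \<in> value_group \<nu>. rep f \<alpha> \<noteq> \<one>\<^bsub>graded_piece \<nu> \<alpha>\<^esub> \<and>
    rep g (\<gamma> - \<alpha>) \<noteq> \<one>\<^bsub>graded_piece \<nu> (\<gamma> - \<alpha>)\<^esub>}"
  let ?h = "\<lambda>\<alpha>. f \<alpha> * g (\<gamma> - \<alpha>)"
  interpret comm_group "graded_piece \<nu> \<gamma>"
    by (rule comm_group_graded_piece)
  show "(rep f \<otimes>\<^bsub>graded_algebra \<nu>\<^esub> rep g) \<gamma> = rep (conv f g) \<gamma>"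
  proof (cases "\<gamma> \<in> value_group \<nu>")
    case False
    then show ?thesis
      by (simp add: graded_algebra_def rep_def)
  next
    case True
    have S: "?S \<subseteq> {\<alpha>. f \<alpha> \<noteq> 0}"
      by (auto simp: rep_def one_graded_piece)
    have finf: "finite {\<alpha>. f \<alpha> \<noteq> 0}"
      using f by (simp add: admissible_def)
    have finS: "finite ?S"
      using S finf by (rule finite_subset)
    have ge: "Fin \<gamma> \<le> \<nu> (?h \<alpha>)" for \<alpha>
      using f g extval_add_mono [of \<alpha> "\<nu> (f \<alpha>)" "\<gamma> - \<alpha>" "\<nu> (g (\<gamma> - \<alpha>))"]
      by (simp add: admissible_def val_mult)
    have "(rep f \<otimes>\<^bsub>graded_algebra \<nu>\<^esub> rep g) \<gamma> = finprod (graded_piece \<nu> \<gamma>)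
        (\<lambda>\<alpha>. piece_mult \<nu> \<alpha> (\<gamma> - \<alpha>) (rep f \<alpha>) (rep g (\<gamma> - \<alpha>))) ?S"
      using True by (simp add: graded_algebra_def)
    also have "\<dots> = finprod (graded_piece \<nu> \<gamma>) (\<lambda>\<alpha>. in_class \<nu> \<gamma> (?h \<alpha>)) ?S"
    proof (rule finprod_cong')
      show "(\<lambda>\<alpha>. in_class \<nu> \<gamma> (?h \<alpha>)) \<in> ?S \<rightarrow> carrier (graded_piece \<nu> \<gamma>)"
        using ge by (auto simp: carrier_graded_piece val_ge_def)
      fix \<alpha> assume "\<alpha> \<in> ?S"
      then have "\<alpha> \<in> value_group \<nu>" "\<gamma> - \<alpha> \<in> value_group \<nu>"
        using value_group_diff True by auto
      then show "piece_mult \<nu> \<alpha> (\<gamma> - \<alpha>) (rep f \<alpha>) (rep g (\<gamma> - \<alpha>)) = in_class \<nu> \<gamma> (?h \<alpha>)"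
        using f g piece_mult_in_class [of \<alpha> "f \<alpha>" "\<gamma> - \<alpha>" "g (\<gamma> - \<alpha>)"]
        by (simp add: rep_def admissible_def)
    qed simp
    also have "\<dots> = in_class \<nu> \<gamma> (sum ?h ?S)"
      using finS ge by (rule in_class_sum)
    also have "\<dots> = in_class \<nu> \<gamma> (conv f g \<gamma>)"
    proof -
      have "conv f g \<gamma> = sum ?h ?S + sum ?h ({\<alpha>. f \<alpha> \<noteq> 0} - ?S)"
        unfolding conv_def using sum.subset_diff [OF S finf, of ?h] by (simp add: add.commute)
      moreover have "Fin \<gamma> < \<nu> (sum ?h ({\<alpha>. f \<alpha> \<noteq> 0} - ?S))"
      proof (rule val_sum_gt)
        fix \<alpha> assume \<alpha>: "\<alpha> \<in> {\<alpha>. f \<alpha> \<noteq> 0} - ?S"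
        then have "\<alpha> \<in> value_group \<nu>" "\<gamma> - \<alpha> \<in> value_group \<nu>"
          using f value_group_diff True by (auto simp: admissible_def)
        then have "Fin \<alpha> < \<nu> (f \<alpha>) \<or> Fin (\<gamma> - \<alpha>) < \<nu> (g (\<gamma> - \<alpha>))"
          using \<alpha> by (auto simp: rep_def one_graded_piece in_class_eq_iff)
        then show "Fin \<gamma> < \<nu> (?h \<alpha>)"
          using f g extval_add_less_le_mono [of \<alpha> "\<nu> (f \<alpha>)" "\<gamma> - \<alpha>" "\<nu> (g (\<gamma> - \<alpha>))"]
            extval_add_le_less_mono [of \<alpha> "\<nu> (f \<alpha>)" "\<gamma> - \<alpha>" "\<nu> (g (\<gamma> - \<alpha>))"]
          by (auto simp: admissible_def val_mult)
      qed
      ultimately show ?thesis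
        by (simp add: in_class_eq_iff)
    qed
    finally show ?thesis
      using True by (simp add: rep_def)
  qed
qed

lemma conv_single: "admissible f \<Longrightarrow> conv f (single \<beta> g) \<gamma> = f (\<gamma> - \<beta>) * g"
proof -
  assume "admissible f"
  then have "finite {\<alpha>. f \<alpha> \<noteq> 0}"
    by (simp add: admissible_def)
  moreover have "\<gamma> - \<alpha> = \<beta> \<longleftrightarrow> \<alpha> = \<gamma> - \<beta>" for \<alpha>
    by auto
  ultimately show ?thesis
    by (auto simp: conv_def single_def if_distrib [of "\<lambda>x. _ * x"] cong: if_cong)
qed

lemma admissible_single: "\<nu> g = Fin \<alpha> \<Longrightarrow> admissible (single \<alpha> g)"
  using value_group_value [of g \<alpha>] by (auto simp: admissible_def single_def)

lemma initial_form_rep: "\<nu> g = Fin \<alpha> \<Longrightarrow> initial_form \<nu> g = rep (single \<alpha> g)"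
  by (auto simp: initial_form_def homogeneous_def rep_def single_def one_graded_piece intro!: restrict_ext)

lemma zero_rep: "\<zero>\<^bsub>graded_algebra \<nu>\<^esub> = rep (\<lambda>_. 0)"
  by (simp add: graded_algebra_def rep_def one_graded_piece)

lemma one_rep: "\<one>\<^bsub>graded_algebra \<nu>\<^esub> = initial_form \<nu> 1"
  by (simp add: graded_algebra_def initial_form_def)

lemma initial_form_Infty: "\<nu> g = Infty \<Longrightarrow> initial_form \<nu> g = \<zero>\<^bsub>graded_algebra \<nu>\<^esub>"
  by (simp add: initial_form_def)

lemma initial_form_carrier: "\<nu> g \<noteq> Infty \<Longrightarrow> initial_form \<nu> g \<in> carrier (graded_algebra \<nu>)"
  by (cases "\<nu> g") (auto simp: initial_form_rep intro: rep_in_carrier admissible_single)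

lemma initial_form_mult:
  assumes "\<nu> f \<noteq> Infty" "\<nu> g \<noteq> Infty"
  shows "initial_form \<nu> f \<otimes>\<^bsub>graded_algebra \<nu>\<^esub> initial_form \<nu> g = initial_form \<nu> (f * g)"
proof -
  obtain \<alpha> \<beta> where \<alpha>: "\<nu> f = Fin \<alpha>" and \<beta>: "\<nu> g = Fin \<beta>"
    using assms by (cases "\<nu> f"; cases "\<nu> g") auto
  have "conv (single \<alpha> f) (single \<beta> g) = single (\<alpha> + \<beta>) (f * g)"
    unfolding conv_single [OF admissible_single [OF \<alpha>]] fun_eq_iff
    by (auto simp: single_def algebra_simps)
  moreover have "\<nu> (f * g) = Fin (\<alpha> + \<beta>)"
    by (simp add: val_mult \<alpha> \<beta>)
  ultimately show ?thesis
    by (simp add: initial_form_rep \<alpha> \<beta> rep_mult admissible_single)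
qed

lemma initial_form_eq:
  assumes "\<nu> f < \<nu> (f - g)"
  shows "initial_form \<nu> f = initial_form \<nu> g"
proof -
  have "\<nu> (f + - (f - g)) = \<nu> f"
    using assms val_uminus [of "f - g"] by (intro val_add_eq) simp
  then have g: "\<nu> g = \<nu> f"
    by simp
  obtain \<alpha> where \<alpha>: "\<nu> f = Fin \<alpha>"
    using assms by (cases "\<nu> f") auto
  have "rep (single \<alpha> f) = rep (single \<alpha> g)"
    using assms by (simp add: rep_eq_iff single_def \<alpha>)
  then show ?thesis
    by (simp add: initial_form_rep \<alpha> g)
qed


section \<open>MacLane-Vaquie key polynomials in terms of remainders\<close>

text \<open>
  The ring axioms of the graded algebra are part of the primality of the ideal generated by the
  initial form of \<open>\<phi>\<close>.
\<close>

lemma MLV_key_polynomial_cring: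
  "\<phi> \<in> MLV_key_polynomials \<nu> \<Longrightarrow> cring (graded_algebra \<nu>)"
  unfolding MLV_key_polynomials_def by (auto dest: primeideal.axioms(2))

text \<open>
  If \<open>\<nu>(f) > \<nu>(f mod \<phi>)\<close>, then \<open>f mod \<phi>\<close> has the same initial form as a multiple of \<open>\<phi>\<close>, against the
  minimality of \<open>\<phi>\<close>. Polynomials of infinite value have initial form \<open>0\<close>, which is divisible by every
  initial form; so \<open>0\<close> is the only one among the polynomials of degree below \<open>deg \<phi>\<close>, and then,
  dividing by \<open>\<phi>\<close> repeatedly, among all polynomials.
\<close>

lemma MLV_key_polynomial_val_minimal:
  assumes \<phi>: "\<phi> \<in> MLV_key_polynomials \<nu>"
  shows "val_minimal \<phi>"
proof -
  let ?G = "graded_algebra \<nu>"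
  interpret cring ?G
    using \<phi> by (rule MLV_key_polynomial_cring)
  have monic: "lead_coeff \<phi> = 1"
    and prime: "primeideal (PIdl\<^bsub>?G\<^esub> (initial_form \<nu> \<phi>)) ?G"
    and nonzero: "PIdl\<^bsub>?G\<^esub> (initial_form \<nu> \<phi>) \<noteq> {\<zero>\<^bsub>?G\<^esub>}"
    and minimal: "\<And>f. f \<noteq> 0 \<Longrightarrow> degree f < degree \<phi> \<Longrightarrow> \<not> val_divides \<nu> \<phi> f"
    using \<phi> by (auto simp: MLV_key_polynomials_def)
  have fin: "\<nu> \<phi> \<noteq> Infty"
  proof
    assume "\<nu> \<phi> = Infty"
    then have "PIdl\<^bsub>?G\<^esub> (initial_form \<nu> \<phi>) = {\<zero>\<^bsub>?G\<^esub>}"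
      by (auto simp: initial_form_Infty cgenideal_def intro!: exI [of _ "\<zero>\<^bsub>?G\<^esub>"])
    then show False
      using nonzero by simp
  qed
  have deg: "0 < degree \<phi>"
  proof (rule ccontr)
    assume "\<not> 0 < degree \<phi>"
    then have "\<phi> = 1"
      using monic by (metis degree_eq_zeroE gr0I lead_coeff_pCons(2) one_pCons)
    then have "initial_form \<nu> \<phi> = \<one>\<^bsub>?G\<^esub>"
      by (simp add: one_rep)
    then have "PIdl\<^bsub>?G\<^esub> (initial_form \<nu> \<phi>) = carrier ?G"
      unfolding cgenideal_def by (force intro: r_one [symmetric])
    then show False
      using primeideal.I_notcarr [OF prime] by simp
  qed
  have small_finite: "\<nu> f \<noteq> Infty" if "f \<noteq> 0" "degree f < degree \<phi>" for f
  proof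
    assume "\<nu> f = Infty"
    then have "initial_form \<nu> f = initial_form \<nu> \<phi> \<otimes>\<^bsub>?G\<^esub> \<zero>\<^bsub>?G\<^esub>"
      using initial_form_carrier [OF fin] by (simp add: initial_form_Infty)
    then have "val_divides \<nu> \<phi> f"
      unfolding val_divides_def factor_def by blast
    then show False
      using minimal that by blast
  qed
  have remainder: "\<nu> f \<le> \<nu> (f mod \<phi>)" for f
  proof (rule ccontr)
    define r h where "r = f mod \<phi>" and "h = - (f div \<phi>)"
    assume "\<not> \<nu> f \<le> \<nu> (f mod \<phi>)"
    then have less: "\<nu> r < \<nu> f"
      by (simp add: r_def)
    then have r0: "r \<noteq> 0"
      by auto
    then have rdeg: "degree r < degree \<phi>"
      unfolding r_def using deg by (intro degree_mod_less_pos)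
    have f: "r - \<phi> * h = f"
      by (simp add: r_def h_def)
    have "\<nu> (r + - f) = \<nu> r"
      using less by (intro val_add_eq) simp
    moreover have "r + - f = \<phi> * h"
      using f by (simp add: algebra_simps)
    ultimately have "\<nu> (\<phi> * h) \<noteq> Infty"
      using small_finite [OF r0 rdeg] by simp
    then have h: "\<nu> h \<noteq> Infty"
      by (simp add: val_mult)
    have "initial_form \<nu> r = initial_form \<nu> (\<phi> * h)"
      using less f by (intro initial_form_eq) simp
    also have "\<dots> = initial_form \<nu> \<phi> \<otimes>\<^bsub>?G\<^esub> initial_form \<nu> h"
      using initial_form_mult [OF fin h] by simp
    finally have "val_divides \<nu> \<phi> r"
      unfolding val_divides_def factor_def using initial_form_carrier [OF h] by blast
    then show False
      using minimal r0 rdeg by blast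
  qed
  have "f = 0" if "\<nu> f = Infty" for f
    using that
  proof (induction "degree f" arbitrary: f rule: less_induct)
    case less
    have "\<nu> (f mod \<phi>) = Infty"
      using remainder [of f] less.prems by simp
    then have mod: "f mod \<phi> = 0"
      using small_finite [OF _ degree_mod_less_pos [OF deg]] by blast
    then have f: "f = \<phi> * (f div \<phi>)"
      by (metis mod_0_imp_dvd dvd_mult_div_cancel)
    then have div: "\<nu> (f div \<phi>) = Infty"
      using less.prems fin val_mult by (metis extval_add_eq_Infty_iff)
    show ?case
    proof (cases "degree f < degree \<phi>")
      case True
      then show ?thesis
        using mod by (simp add: mod_poly_less)
    next
      case False
      then have "degree (f div \<phi>) < degree f"
        using deg by (intro degree_div_less) auto
      then have "f div \<phi> = 0"
        using less.hyps div by blast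
      then show ?thesis
        using f by simp
    qed
  qed
  then show ?thesis
    using monic deg fin remainder by (auto simp: val_minimal_def)
qed

lemma rep_mult_initial_form:
  assumes "\<nu> g = Fin \<beta>" "admissible h"
  shows "rep h \<otimes>\<^bsub>graded_algebra \<nu>\<^esub> initial_form \<nu> g = rep (\<lambda>\<alpha>. h (\<alpha> - \<beta>) * g)"
proof -
  have "conv h (single \<beta> g) = (\<lambda>\<alpha>. h (\<alpha> - \<beta>) * g)"
    using conv_single [OF assms(2)] by blast
  then show ?thesis
    using rep_mult [OF assms(2) admissible_single [OF assms(1)]] by (simp add: initial_form_rep assms(1))
qed

text \<open>
  Membership in the ideal of the initial form of \<open>Q\<close> can be tested on remainders: a representative
  differs from its remainder by a multiple of \<open>Q\<close>, and passing to remainders does not lower the value.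
\<close>

lemma rep_in_principal_idealD:
  assumes Q: "val_minimal Q"
    and f: "rep f \<in> PIdl\<^bsub>graded_algebra \<nu>\<^esub> (initial_form \<nu> Q)" and \<alpha>: "\<alpha> \<in> value_group \<nu>"
  shows "Fin \<alpha> < \<nu> (f \<alpha> mod Q)"
proof -
  obtain \<beta> where \<beta>: "\<nu> Q = Fin \<beta>"
    using Q by (cases "\<nu> Q") (auto simp: val_minimal_def)
  obtain x where "x \<in> carrier (graded_algebra \<nu>)"
    "rep f = x \<otimes>\<^bsub>graded_algebra \<nu>\<^esub> initial_form \<nu> Q"
    using f by (auto simp: cgenideal_def)
  then obtain h where "admissible h" "rep f = rep h \<otimes>\<^bsub>graded_algebra \<nu>\<^esub> initial_form \<nu> Q"
    by (metis carrier_rep)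
  then have "Fin \<alpha> < \<nu> (f \<alpha> - h (\<alpha> - \<beta>) * Q)"
    using \<alpha> by (simp add: rep_mult_initial_form [OF \<beta>] rep_eq_iff)
  also have "\<dots> \<le> \<nu> ((f \<alpha> - h (\<alpha> - \<beta>) * Q) mod Q)"
    using Q unfolding val_minimal_def by blast
  finally show ?thesis
    by (simp add: poly_mod_diff_left)
qed

lemma rep_in_principal_idealI:
  assumes Q: "val_minimal Q" and f: "admissible f"
    and rem: "\<And>\<alpha>. \<alpha> \<in> value_group \<nu> \<Longrightarrow> Fin \<alpha> < \<nu> (f \<alpha> mod Q)"
  shows "rep f \<in> PIdl\<^bsub>graded_algebra \<nu>\<^esub> (initial_form \<nu> Q)"
proof -
  obtain \<beta> where \<beta>: "\<nu> Q = Fin \<beta>"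
    using Q by (cases "\<nu> Q") (auto simp: val_minimal_def)
  \<comment> \<open>The cofactor: multiplication by \<open>Q\<close> raises degrees by \<open>\<beta> = \<nu>(Q)\<close>.\<close>
  define h where "h = (\<lambda>\<alpha>. f (\<alpha> + \<beta>) div Q)"
  have supp: "{\<alpha>. h \<alpha> \<noteq> 0} \<subseteq> (\<lambda>\<alpha>. \<alpha> - \<beta>) ` {\<alpha>. f \<alpha> \<noteq> 0}"
  proof
    fix \<alpha> assume "\<alpha> \<in> {\<alpha>. h \<alpha> \<noteq> 0}"
    then have "f (\<alpha> + \<beta>) \<noteq> 0"
      by (auto simp: h_def)
    then show "\<alpha> \<in> (\<lambda>\<alpha>. \<alpha> - \<beta>) ` {\<alpha>. f \<alpha> \<noteq> 0}"
      by (intro image_eqI [of _ _ "\<alpha> + \<beta>"]) auto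
  qed
  have h: "admissible h"
    unfolding admissible_def
  proof (intro conjI allI)
    show "finite {\<alpha>. h \<alpha> \<noteq> 0}"
      using supp f by (auto simp: admissible_def intro: finite_subset)
    show "{\<alpha>. h \<alpha> \<noteq> 0} \<subseteq> value_group \<nu>"
      using supp f value_group_diff value_group_value [OF \<beta>] by (fastforce simp: admissible_def)
    fix \<alpha>
    have "Fin (\<alpha> + \<beta>) \<le> \<nu> (f (\<alpha> + \<beta>))"
      using f by (simp add: admissible_def)
    also have "\<dots> \<le> \<nu> (Q * h \<alpha>)"
      unfolding h_def using Q by (rule val_minimal_div)
    finally show "Fin \<alpha> \<le> \<nu> (h \<alpha>)"
      by (cases "\<nu> (h \<alpha>)") (auto simp: val_mult \<beta> algebra_simps)
  qed
  have "rep f = rep h \<otimes>\<^bsub>graded_algebra \<nu>\<^esub> initial_form \<nu> Q"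
    unfolding rep_mult_initial_form [OF \<beta> h] rep_eq_iff
    using rem by (simp add: h_def minus_div_mult_eq_mod)
  then show ?thesis
    unfolding cgenideal_def using rep_in_carrier [OF h] by blast
qed

text \<open>
  An element outside the ideal has a least degree in which its component is outside. For two such
  elements, with least degrees \<open>\<alpha>\<close> and \<open>\<beta>\<close>, consider the component of degree \<open>\<alpha> + \<beta>\<close> of the product:
  apart from the product of the components of degrees \<open>\<alpha>\<close> and \<open>\<beta>\<close>, each summand has a factor of degree
  below \<open>\<alpha>\<close> or below \<open>\<beta>\<close> and lies in the ideal. The remaining summand is outside, because reducing a
  product of two remainders modulo \<open>Q\<close> does not change its value.
\<close>

lemma principal_ideal_prime:
  assumes Q: "val_minimal Q"
    and mult: "\<And>f g. degree f < degree Q \<Longrightarrow> degree g < degree Q \<Longrightarrow> \<nu> ((f * g) mod Q) = \<nu> (f * g)"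
    and ab: "a \<in> carrier (graded_algebra \<nu>)" "b \<in> carrier (graded_algebra \<nu>)"
      "a \<otimes>\<^bsub>graded_algebra \<nu>\<^esub> b \<in> PIdl\<^bsub>graded_algebra \<nu>\<^esub> (initial_form \<nu> Q)"
  shows "a \<in> PIdl\<^bsub>graded_algebra \<nu>\<^esub> (initial_form \<nu> Q) \<or>
    b \<in> PIdl\<^bsub>graded_algebra \<nu>\<^esub> (initial_form \<nu> Q)"
proof (rule ccontr)
  assume notin: "\<not> ?thesis"
  obtain f g where f: "admissible f" "a = rep f" and g: "admissible g" "b = rep g"
    using ab by (metis carrier_rep)
  define bad where "bad = (\<lambda>h. {\<alpha> \<in> value_group \<nu>. \<not> Fin \<alpha> < \<nu> (h \<alpha> mod Q)})"
  have bad_supp: "bad h \<subseteq> {\<alpha>. h \<alpha> \<noteq> 0}" for h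
    by (auto simp: bad_def)
  have least: "\<exists>\<alpha>\<in>bad h. \<forall>\<beta>\<in>value_group \<nu>. \<beta> < \<alpha> \<longrightarrow> Fin \<beta> < \<nu> (h \<beta> mod Q)"
    if h: "admissible h" "rep h \<notin> PIdl\<^bsub>graded_algebra \<nu>\<^esub> (initial_form \<nu> Q)" for h
  proof -
    have "finite (bad h)"
      using bad_supp h(1) by (auto simp: admissible_def intro: finite_subset)
    moreover have "bad h \<noteq> {}"
      using rep_in_principal_idealI [OF Q h(1)] h(2) by (auto simp: bad_def)
    ultimately have "Min (bad h) \<in> bad h" "\<And>\<beta>. \<beta> \<in> bad h \<Longrightarrow> Min (bad h) \<le> \<beta>"
      by (auto intro: Min_in)
    then show ?thesis
      by (intro bexI [of _ "Min (bad h)"] ballI impI) (auto simp: bad_def dest: leD)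
  qed
  obtain \<alpha> where \<alpha>: "\<alpha> \<in> bad f" and \<alpha>_least: "\<And>\<beta>. \<beta> \<in> value_group \<nu> \<Longrightarrow> \<beta> < \<alpha> \<Longrightarrow> Fin \<beta> < \<nu> (f \<beta> mod Q)"
    using least [OF f(1)] notin f(2) by blast
  obtain \<beta> where \<beta>: "\<beta> \<in> bad g" and \<beta>_least: "\<And>\<alpha>. \<alpha> \<in> value_group \<nu> \<Longrightarrow> \<alpha> < \<beta> \<Longrightarrow> Fin \<alpha> < \<nu> (g \<alpha> mod Q)"
    using least [OF g(1)] notin g(2) by blast
  define \<gamma> where "\<gamma> = \<alpha> + \<beta>"
  have VG: "\<alpha> \<in> value_group \<nu>" "\<beta> \<in> value_group \<nu>" "\<gamma> \<in> value_group \<nu>"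
    using \<alpha> \<beta> value_group_add by (auto simp: bad_def \<gamma>_def)
  have rem: "\<nu> h \<le> \<nu> (h mod Q)" for h
    using Q by (simp add: val_minimal_def)
  have other: "Fin \<gamma> < \<nu> ((f \<alpha>' * g (\<gamma> - \<alpha>')) mod Q)" if \<alpha>': "\<alpha>' \<noteq> \<alpha>" "f \<alpha>' \<noteq> 0" for \<alpha>'
  proof -
    have \<alpha>'VG: "\<alpha>' \<in> value_group \<nu>" "\<gamma> - \<alpha>' \<in> value_group \<nu>"
      using f(1) \<alpha>' VG value_group_diff by (auto simp: admissible_def)
    have ge: "Fin \<alpha>' \<le> \<nu> (f \<alpha>')" "Fin (\<gamma> - \<alpha>') \<le> \<nu> (g (\<gamma> - \<alpha>'))"
      using f(1) g(1) by (simp_all add: admissible_def)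
    show ?thesis
    proof (cases "\<alpha>' < \<alpha>")
      case True
      then have "Fin \<gamma> < \<nu> ((f \<alpha>' mod Q) * g (\<gamma> - \<alpha>'))"
        using extval_add_less_le_mono [OF \<alpha>_least [OF \<alpha>'VG(1) True] ge(2)] by (simp add: val_mult)
      also have "\<dots> \<le> \<nu> ((f \<alpha>' mod Q) * g (\<gamma> - \<alpha>') mod Q)"
        by (rule rem)
      finally show ?thesis
        by (simp add: mod_mult_left_eq)
    next
      case False
      then have "\<gamma> - \<alpha>' < \<beta>"
        using \<alpha>' by (simp add: \<gamma>_def algebra_simps)
      then have "Fin \<gamma> < \<nu> (f \<alpha>' * (g (\<gamma> - \<alpha>') mod Q))"
        using extval_add_le_less_mono [OF ge(1) \<beta>_least [OF \<alpha>'VG(2)]] by (simp add: val_mult)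
      also have "\<dots> \<le> \<nu> (f \<alpha>' * (g (\<gamma> - \<alpha>') mod Q) mod Q)"
        by (rule rem)
      finally show ?thesis
        by (simp add: mod_mult_right_eq)
    qed
  qed
  have Q0: "Q \<noteq> 0" "0 < degree Q"
    using Q by (auto simp: val_minimal_def)
  have mod_sum: "Fin \<gamma> < \<nu> (sum h A mod Q)" if "\<And>i. i \<in> A \<Longrightarrow> Fin \<gamma> < \<nu> (h i mod Q)"
    for h :: "'v \<Rightarrow> 'a poly" and A
    using that by (induction A rule: infinite_finite_induct) (auto simp: poly_mod_add_left intro: val_add_gt)
  let ?h = "\<lambda>\<alpha>'. f \<alpha>' * g (\<gamma> - \<alpha>')"
  let ?rest = "sum ?h ({\<alpha>. f \<alpha> \<noteq> 0} - {\<alpha>})"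
  have rest: "Fin \<gamma> < \<nu> (?rest mod Q)"
    using other by (intro mod_sum) auto
  have "conv f g \<gamma> = f \<alpha> * g \<beta> + ?rest"
    unfolding conv_def using f(1) \<alpha> bad_supp [of f]
    by (subst sum.remove [of _ \<alpha>]) (auto simp: admissible_def \<gamma>_def)
  then have "(f \<alpha> * g \<beta>) mod Q = conv f g \<gamma> mod Q - ?rest mod Q"
    by (simp add: poly_mod_add_left)
  moreover have "Fin \<gamma> < \<nu> (conv f g \<gamma> mod Q)"
    using ab(3) VG f g by (intro rep_in_principal_idealD [OF Q]) (simp_all add: rep_mult)
  ultimately have "Fin \<gamma> < \<nu> ((f \<alpha> * g \<beta>) mod Q)"
    using rest by (simp add: val_diff_gt)
  moreover have "\<nu> ((f \<alpha> * g \<beta>) mod Q) = \<nu> (f \<alpha> mod Q) + \<nu> (g \<beta> mod Q)"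
  proof -
    have small: "degree (h mod Q) < degree Q" for h
      using Q0(2) by (rule degree_mod_less_pos)
    have "(f \<alpha> * g \<beta>) mod Q = ((f \<alpha> mod Q) * (g \<beta> mod Q)) mod Q"
      by (simp add: mod_mult_eq)
    then show ?thesis
      using mult [OF small small] by (simp add: val_mult)
  qed
  moreover have "\<nu> (f \<alpha> mod Q) + \<nu> (g \<beta> mod Q) \<le> Fin \<gamma>"
    using \<alpha> \<beta> add_mono [of "\<nu> (f \<alpha> mod Q)" "Fin \<alpha>" "\<nu> (g \<beta> mod Q)" "Fin \<beta>"]
    by (simp add: bad_def \<gamma>_def not_less)
  ultimately show False
    by simp
qed

text \<open>
  The test on remainders shows that no nonzero polynomial of degree below \<open>deg Q\<close> has its initial
  form in the ideal, being its own remainder. Applied to the polynomial \<open>1\<close>, this makes the ideal proper.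
\<close>

lemma MLV_key_polynomialI:
  assumes cring: "cring (graded_algebra \<nu>)" and Q: "val_minimal Q"
    and mult: "\<And>f g. degree f < degree Q \<Longrightarrow> degree g < degree Q \<Longrightarrow> \<nu> ((f * g) mod Q) = \<nu> (f * g)"
  shows "Q \<in> MLV_key_polynomials \<nu>"
proof -
  let ?G = "graded_algebra \<nu>"
  interpret cring ?G
    by (rule cring)
  have Q0: "lead_coeff Q = 1" "0 < degree Q" "\<nu> Q \<noteq> Infty" "\<And>f. f \<noteq> 0 \<Longrightarrow> \<nu> f \<noteq> Infty"
    using Q by (auto simp: val_minimal_def)
  have inQ: "initial_form \<nu> Q \<in> carrier ?G"
    using Q0(3) by (rule initial_form_carrier)
  have small: "initial_form \<nu> f \<notin> PIdl\<^bsub>?G\<^esub> (initial_form \<nu> Q)" if f: "f \<noteq> 0" "degree f < degree Q" for f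
  proof
    assume mem: "initial_form \<nu> f \<in> PIdl\<^bsub>?G\<^esub> (initial_form \<nu> Q)"
    obtain \<alpha> where \<alpha>: "\<nu> f = Fin \<alpha>"
      using Q0(4) [OF f(1)] by (cases "\<nu> f") auto
    then have "Fin \<alpha> < \<nu> (single \<alpha> f \<alpha> mod Q)"
      using mem rep_in_principal_idealD [OF Q] value_group_value [OF \<alpha>] by (simp add: initial_form_rep)
    then show False
      using f \<alpha> by (simp add: single_def mod_poly_less)
  qed
  have not_one: "\<one>\<^bsub>?G\<^esub> \<notin> PIdl\<^bsub>?G\<^esub> (initial_form \<nu> Q)"
    unfolding one_rep using Q0(2) by (intro small) auto
  have "primeideal (PIdl\<^bsub>?G\<^esub> (initial_form \<nu> Q)) ?G"
  proof (rule primeidealI [OF cgenideal_ideal [OF inQ] cring])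
    show "carrier ?G \<noteq> PIdl\<^bsub>?G\<^esub> (initial_form \<nu> Q)"
      using not_one one_closed by blast
  qed (rule principal_ideal_prime [OF Q mult])
  moreover have "PIdl\<^bsub>?G\<^esub> (initial_form \<nu> Q) \<noteq> {\<zero>\<^bsub>?G\<^esub>}"
  proof
    assume "PIdl\<^bsub>?G\<^esub> (initial_form \<nu> Q) = {\<zero>\<^bsub>?G\<^esub>}"
    then have zero: "rep (\<lambda>_. 0) = initial_form \<nu> Q"
      using cgenideal_self [OF inQ] zero_rep by simp
    obtain \<beta> where \<beta>: "\<nu> Q = Fin \<beta>"
      using Q0 by (cases "\<nu> Q") auto
    then have "Fin \<beta> < \<nu> (0 - single \<beta> Q \<beta>)"
      using zero value_group_value [OF \<beta>] by (simp only: initial_form_rep rep_eq_iff)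
    then show False
      by (simp add: single_def \<beta>)
  qed
  moreover have "\<not> val_divides \<nu> Q f" if f: "f \<noteq> 0" "degree f < degree Q" for f
  proof
    assume "val_divides \<nu> Q f"
    then have "initial_form \<nu> f \<in> PIdl\<^bsub>?G\<^esub> (initial_form \<nu> Q)"
      using inQ m_comm by (auto simp: val_divides_def factor_def cgenideal_def)
    then show False
      using small [OF f] by simp
  qed
  ultimately show ?thesis
    using Q0 by (simp add: MLV_key_polynomials_def)
qed

end


section \<open>Key polynomials of minimal degree\<close>

theorem theorem2p18:
  fixes \<nu> :: "'a::field poly \<Rightarrow> 'v::linordered_ab_group_add extval"
    and \<phi> :: "'a poly"
  assumes "poly_valuation \<nu>"
    and "\<phi> \<in> MLV_key_polynomials \<nu>"
  shows "(key_polynomial \<nu> \<phi> \<longleftrightarrow> degree \<phi> = val_degree \<nu>) \<and>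
    (key_polynomial \<nu> \<phi> \<longrightarrow> truncation \<nu> \<phi> = \<nu>)"
proof -
  interpret valued_polynomials \<nu>
    by unfold_locales (rule assms(1))
  have \<phi>: "val_minimal \<phi>"
    using assms(2) by (rule MLV_key_polynomial_val_minimal)
  have least: "val_degree \<nu> \<le> degree \<psi>" if "\<psi> \<in> MLV_key_polynomials \<nu>" for \<psi>
    unfolding val_degree_def using that by (intro Least_le) blast
  have "degree \<phi> = val_degree \<nu>" if key: "key_polynomial \<nu> \<phi>"
  proof -
    have "\<exists>\<psi>\<in>MLV_key_polynomials \<nu>. degree \<psi> = val_degree \<nu>"
      unfolding val_degree_def by (rule LeastI_ex) (use assms(2) in blast)
    then obtain \<psi> where \<psi>: "\<psi> \<in> MLV_key_polynomials \<nu>" "degree \<psi> = val_degree \<nu>"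
      by blast
    then have \<psi>min: "val_minimal \<psi>"
      by (intro MLV_key_polynomial_val_minimal)
    have "\<not> degree \<psi> < degree \<phi>"
    proof
      assume "degree \<psi> < degree \<phi>"
      then have "epsilon \<nu> \<psi> < epsilon \<nu> \<phi>"
        using key \<psi>min by (simp add: key_polynomial_def val_minimal_def)
      moreover have "epsilon \<nu> \<phi> \<le> epsilon \<nu> \<psi>"
        using \<phi> by (intro epsilon_le_val_minimal [OF \<psi>min]) (simp add: val_minimal_def)
      ultimately show False
        by simp
    qed
    then show ?thesis
      using least [OF assms(2)] \<psi>(2) by simp
  qed
  moreover have "key_polynomial \<nu> \<phi>" if degree: "degree \<phi> = val_degree \<nu>"
  proof (rule ccontr)
    assume "\<not> key_polynomial \<nu> \<phi>"
    then obtain Q where Q: "key_polynomial \<nu> Q" "degree Q < degree \<phi>" "epsilon \<nu> Q = epsilon \<nu> \<phi>"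
      using smaller_key_polynomial_exists [OF \<phi>] by blast
    obtain \<delta> where \<delta>: "epsilon \<nu> \<phi> = Fin \<delta>"
      using \<phi> epsilon_finite unfolding val_minimal_def by blast
    have "Q \<in> MLV_key_polynomials \<nu>"
    proof (rule MLV_key_polynomialI)
      show "cring (graded_algebra \<nu>)"
        using assms(2) by (rule MLV_key_polynomial_cring)
      have fin: "\<nu> f \<noteq> Infty" if "f \<noteq> 0" for f
        using \<phi> that by (simp add: val_minimal_def)
      note maximal = key_polynomial_of_maximal_level [OF fin Q(1) Q(3) [unfolded \<delta>] eps_le_val_minimal [OF \<phi> \<delta>]]
      show "val_minimal Q"
        by (rule maximal(1))
      show "\<nu> ((f * g) mod Q) = \<nu> (f * g)" if "degree f < degree Q" "degree g < degree Q" for f g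
        by (rule maximal(2)) (use that in auto)
    qed
    then show False
      using least [of Q] Q(2) degree by simp
  qed
  ultimately show ?thesis
    using truncation_val_minimal [OF \<phi>] by blast
qed

end
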